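(* Let $\mu$ be a measure on $\Omega$, let $\theta>0$, let $|||\cdot|||$ be a unitarily invariant norm, and let $(\mathscr{A}_t)_{t\in\Omega}$, $(\mathscr{B}_t)_{t\in\Omega}$ be weakly$^*$ measurable fields of bounded operators on $\mathcal H$ such that $\int_\Omega|\mathscr{A}_t|^2d\mu(t)$ and $\int_\Omega|\mathscr{B}_t|^2d\mu(t)$ exist as bounded operators and $\left|\int_\Omega|\mathscr{A}_t|^2d\mu(t)\right|^\theta$ and $\left|\int_\Omega|\mathscr{B}_t|^2d\mu(t)\right|^\theta$ belong to $\mathcal{C}_{|||\cdot|||}(\mathcal{H})$. Then \[ \left|\left|\left|\,\left|\int_\Omega \mathscr{A}_t^*\mathscr{B}_t\,d\mu(t)\right|^\theta \right|\right|\right|\le \left|\left|\left|\,\left|\int_\Omega \mathscr{A}_t^*\mathscr{A}_t\,d\mu(t)\right|^\theta \right|\right|\right|^{1/2} \left|\left|\left|\,\left|\int_\Omega \mathscr{B}_t^*\mathscr{B}_t\,d\mu(t)\right|^\theta \right|\right|\right|^{1/2}. \]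
   Context: $\mathcal{H}$ is a separable complex Hilbert space, $|A|=(A^*A)^{1/2}$. A field $t\mapsto\mathscr{A}_t\in\mathcal{B}(\mathcal{H})$ is weakly$^*$ measurable if $t\mapsto\langle\mathscr{A}_tf,f\rangle$ is measurable for all $f$; integrals of operator fields are Gel'fand (weak) integrals: $\int\mathscr{A}_t\,d\mu(t)$ is the bounded operator $T$ with $\langle Tf,g\rangle=\int\langle\mathscr{A}_tf,g\rangle d\mu(t)$ for all $f,g$. A unitarily invariant norm is $|||X|||=\Phi(s_1(X),s_2(X),\dots)$ for a symmetric gauge function $\Phi$ ($s_n$ singular values); $\mathcal{C}_{|||\cdot|||}(\mathcal{H})$ is the ideal of compact operators on which it is finite. *)

theory Defs
  imports "HOL-Analysis.Analysis"
begin

class complex_hilbert = banach +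
  fixes scaleC :: "complex \<Rightarrow> 'a \<Rightarrow> 'a"
    and cinner :: "'a \<Rightarrow> 'a \<Rightarrow> complex"
  assumes scaleC_add_right: "scaleC a (x + y) = scaleC a x + scaleC a y"
    and scaleC_add_left: "scaleC (a + b) x = scaleC a x + scaleC b x"
    and scaleC_scaleC: "scaleC a (scaleC b x) = scaleC (a * b) x"
    and scaleC_one: "scaleC 1 x = x"
    and scaleC_of_real: "scaleC (complex_of_real r) x = scaleR r x"
    and cinner_commute: "cinner x y = cnj (cinner y x)"
    and cinner_add_left: "cinner (x + y) z = cinner x z + cinner y z"
    and cinner_scaleC_left: "cinner (scaleC a x) y = a * cinner x y"
    and cinner_nonneg: "0 \<le> Re (cinner x x)"
    and cinner_eq_zero_iff: "cinner x x = 0 \<longleftrightarrow> x = 0"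
    and norm_cinner: "norm x = sqrt (Re (cinner x x))"
    and separable: "\<exists>D::'a set. countable D \<and> (\<forall>x e. 0 < e \<longrightarrow> (\<exists>d\<in>D. norm (x - d) < e))"

definition bop :: "('a::complex_hilbert \<Rightarrow> 'a) \<Rightarrow> bool" where
  "bop T \<longleftrightarrow> (\<forall>x y. T (x + y) = T x + T y) \<and> (\<forall>c x. T (scaleC c x) = scaleC c (T x))
     \<and> (\<exists>K. \<forall>x. norm (T x) \<le> K * norm x)"

definition adj :: "('a::complex_hilbert \<Rightarrow> 'a) \<Rightarrow> 'a \<Rightarrow> 'a" where
  "adj T = (\<lambda>y. THE z. \<forall>x. cinner (T x) y = cinner x z)"

text \<open>Power \<open>P^\<theta>\<close> (\<open>\<theta> > 0\<close>) of a positive operator \<open>P\<close> via the continuous functional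
calculus, written out explicitly: with \<open>c = \<parallel>P\<parallel>\<close> and \<open>R = I - P/c\<close> (so \<open>0 \<le> R \<le> I\<close>),
\<open>P^\<theta> = c^\<theta> (I - R)^\<theta> = c^\<theta> \<Sum>\<^sub>k binom(\<theta>,k) (-R)^k\<close> (norm-convergent for \<open>\<theta> > 0\<close>).\<close>
definition oppow :: "('a::complex_hilbert \<Rightarrow> 'a) \<Rightarrow> real \<Rightarrow> 'a \<Rightarrow> 'a" where
  "oppow P \<theta> =
     (let c = onorm P; R = (\<lambda>x. x - scaleR (1 / c) (P x)) in
      if c = 0 then (\<lambda>x. 0)
      else (\<lambda>x. scaleR (c powr \<theta>) (\<Sum>k. scaleR ((-1) ^ k * (\<theta> gchoose k)) ((R ^^ k) x))))"

definition opabs :: "('a::complex_hilbert \<Rightarrow> 'a) \<Rightarrow> 'a \<Rightarrow> 'a" where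
  "opabs A = oppow (adj A \<circ> A) (1/2)"

definition compact_op :: "('a::complex_hilbert \<Rightarrow> 'a) \<Rightarrow> bool" where
  "compact_op T \<longleftrightarrow> bop T \<and> compact (closure (T ` {x. norm x \<le> 1}))"

definition rank_le :: "('a::complex_hilbert \<Rightarrow> 'a) \<Rightarrow> nat \<Rightarrow> bool" where
  "rank_le F n \<longleftrightarrow> (\<exists>v::nat \<Rightarrow> 'a. \<forall>x. \<exists>c. F x = (\<Sum>i<n. scaleC (c i) (v i)))"

text \<open>Singular values \<open>s_1(X) \<ge> s_2(X) \<ge> \<dots>\<close> (indexed from 0 here), as approximation
numbers: \<open>s_{n+1}(X) = inf {\<parallel>X - F\<parallel> : rank F \<le> n}\<close>.\<close>
definition sval :: "('a::complex_hilbert \<Rightarrow> 'a) \<Rightarrow> nat \<Rightarrow> real" where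
  "sval X n = Inf {onorm (\<lambda>x. X x - F x) | F. bop F \<and> rank_le F n}"

definition fin_supp :: "(nat \<Rightarrow> real) \<Rightarrow> bool" where
  "fin_supp x \<longleftrightarrow> finite {n. x n \<noteq> 0}"

definition sym_gauge :: "((nat \<Rightarrow> real) \<Rightarrow> real) \<Rightarrow> bool" where
  "sym_gauge \<Phi> \<longleftrightarrow>
     (\<forall>x. fin_supp x \<longrightarrow> x \<noteq> (\<lambda>n. 0) \<longrightarrow> \<Phi> x > 0) \<and>
     (\<forall>x c. fin_supp x \<longrightarrow> \<Phi> (\<lambda>n. c * x n) = \<bar>c\<bar> * \<Phi> x) \<and>
     (\<forall>x y. fin_supp x \<longrightarrow> fin_supp y \<longrightarrow> \<Phi> (\<lambda>n. x n + y n) \<le> \<Phi> x + \<Phi> y) \<and>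
     (\<forall>x \<pi>. fin_supp x \<longrightarrow> bij \<pi> \<longrightarrow> \<Phi> (x \<circ> \<pi>) = \<Phi> x) \<and>
     (\<forall>x. fin_supp x \<longrightarrow> \<Phi> (\<lambda>n. \<bar>x n\<bar>) = \<Phi> x) \<and>
     \<Phi> (\<lambda>n. if n = 0 then 1 else 0) = 1"

text \<open>\<open>|||X||| = \<Phi>(s_1(X), s_2(X), \<dots>)\<close> (extended by monotone limit of truncations);
it is \<open>\<infinity>\<close> for non-compact \<open>X\<close>.\<close>
definition ui_norm :: "((nat \<Rightarrow> real) \<Rightarrow> real) \<Rightarrow> ('a::complex_hilbert \<Rightarrow> 'a) \<Rightarrow> ennreal" where
  "ui_norm \<Phi> X =
     (if compact_op X then (SUP n. ennreal (\<Phi> (\<lambda>k. if k < n then sval X k else 0))) else \<infinity>)"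

definition ui_ideal :: "((nat \<Rightarrow> real) \<Rightarrow> real) \<Rightarrow> ('a::complex_hilbert \<Rightarrow> 'a) set" where
  "ui_ideal \<Phi> = {X. compact_op X \<and> ui_norm \<Phi> X < \<infinity>}"

definition wstar_measurable :: "'t measure \<Rightarrow> ('t \<Rightarrow> 'a::complex_hilbert \<Rightarrow> 'a) \<Rightarrow> bool" where
  "wstar_measurable M A \<longleftrightarrow>
     (\<forall>t\<in>space M. bop (A t)) \<and> (\<forall>f. (\<lambda>t. cinner (A t f) f) \<in> borel_measurable M)"

definition has_gelfand_integral ::
    "'t measure \<Rightarrow> ('t \<Rightarrow> 'a::complex_hilbert \<Rightarrow> 'a) \<Rightarrow> ('a \<Rightarrow> 'a) \<Rightarrow> bool" where
  "has_gelfand_integral M A T \<longleftrightarrow> bop T \<and>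
     (\<forall>f g. integrable M (\<lambda>t. cinner (A t f) g) \<and>
            cinner (T f) g = (\<integral>t. cinner (A t f) g \<partial>M))"

end

theory Submission
  imports Defs "Jordan_Normal_Form.Determinant"
begin

text \<open>
No spectral theorem is needed. Let \<open>X = \<integral> A\<^sub>t\<^sup>* B\<^sub>t d\<mu>\<close>, \<open>P = \<integral> B\<^sub>t\<^sup>* B\<^sub>t d\<mu>\<close> and \<open>Q = \<integral> A\<^sub>t\<^sup>* A\<^sub>t d\<mu>\<close>;
the Cauchy-Schwarz inequality for the integrals gives
\<open>\<bar>\<langle>X f, g\<rangle>\<bar>\<^sup>2 \<le> \<langle>P f, f\<rangle> \<langle>Q g, g\<rangle>\<close>.

Choose orthonormal \<open>e\<^sub>0, \<dots>, e\<^sub>n\<^sub>-\<^sub>1\<close> and \<open>f\<^sub>0, \<dots>, f\<^sub>n\<^sub>-\<^sub>1\<close> in which \<open>X\<close> is triangular with diagonal entries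
close to its approximation numbers \<open>s\<^sub>k(X)\<close>. Orthogonalising the \<open>e\<^sub>k\<close> with respect to \<open>P\<close> and the
\<open>f\<^sub>k\<close>, in reverse order, with respect to \<open>Q\<close> does not change the diagonal, so its squared entries are
bounded by products of Gram-Schmidt heights. The product of the heights is a Gram determinant, hence
the same for every orthonormal basis of the span, and a basis adapted to the kernels of finite-rank
approximations of \<open>P\<close> bounds it by \<open>\<Prod>\<^sub>k s\<^sub>k(P)\<close>. This gives
\<open>\<Prod>\<^sub>k\<^sub><\<^sub>n s\<^sub>k(X)\<^sup>2 \<le> \<Prod>\<^sub>k\<^sub><\<^sub>n s\<^sub>k(P) s\<^sub>k(Q)\<close>.

Since \<open>s\<^sub>k(\<bar>X\<bar>\<^sup>\<theta>) = s\<^sub>k(X)\<^sup>\<theta>\<close>, which follows from the semigroup law for powers and the log-convexity of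
their moments, the multiplicative inequality persists for \<open>\<theta>\<close>-th powers; it implies weak majorisation,
to which symmetric gauge functions are monotone, and the arithmetic-geometric mean inequality
separates the two factors.
\<close>

subsection \<open>Inner product, Riesz representation and adjoints\<close>

lemma scaleR_scaleC: "scaleR r (x::'a::complex_hilbert) = scaleC (complex_of_real r) x"
  by (simp add: scaleC_of_real)

lemma cinner_add_right: "cinner x (y + z) = cinner x y + cinner x (z::'a::complex_hilbert)"
  by (metis cinner_add_left cinner_commute complex_cnj_add)

lemma cinner_scaleC_right: "cinner x (scaleC a y) = cnj a * cinner x (y::'a::complex_hilbert)"
  by (metis cinner_commute cinner_scaleC_left complex_cnj_mult)

lemma cinner_scaleR_left: "cinner (scaleR r x) y = of_real r * cinner x (y::'a::complex_hilbert)"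
  by (simp add: scaleR_scaleC cinner_scaleC_left)

lemma cinner_scaleR_right: "cinner x (scaleR r y) = of_real r * cinner x (y::'a::complex_hilbert)"
  by (simp add: scaleR_scaleC cinner_scaleC_right)

lemma cinner_self: "cinner x x = complex_of_real ((norm (x::'a::complex_hilbert))\<^sup>2)"
proof -
  have "cnj (cinner x x) = cinner x x" by (metis cinner_commute)
  then have "Im (cinner x x) = 0" by (simp add: complex_eq_iff)
  then show ?thesis
    by (simp add: complex_eq_iff norm_cinner cinner_nonneg)
qed

lemma Re_cinner_self: "Re (cinner x x) = (norm (x::'a::complex_hilbert))\<^sup>2"
  by (simp add: cinner_self)

lemma norm_scaleC: "norm (scaleC a (x::'a::complex_hilbert)) = cmod a * norm x"
proof -
  have "complex_of_real ((norm (scaleC a x))\<^sup>2) = (a * cnj a) * cinner x x"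
    by (simp only: cinner_self[symmetric] cinner_scaleC_left cinner_scaleC_right mult.assoc mult.left_commute)
  also have "\<dots> = complex_of_real ((cmod a * norm x)\<^sup>2)"
    by (simp only: cinner_self complex_norm_square[symmetric] of_real_mult[symmetric] power_mult_distrib)
  finally have "(norm (scaleC a x))\<^sup>2 = (cmod a * norm x)\<^sup>2" by (simp only: of_real_eq_iff)
  then show ?thesis by (rule power2_eq_imp_eq) auto
qed

lemma Re_cinner_commute: "Re (cinner y x) = Re (cinner x (y::'a::complex_hilbert))"
  by (subst cinner_commute) simp

lemma power2_norm_add:
  "(norm (x + y))\<^sup>2 = (norm x)\<^sup>2 + (norm y)\<^sup>2 + 2 * Re (cinner x (y::'a::complex_hilbert))"
  using Re_cinner_commute[of x y]
  by (simp add: Re_cinner_self[symmetric] cinner_add_left cinner_add_right)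

text \<open>The discriminant argument, stated for bare numbers so that it serves the inner product,
  semidefinite forms and integrals alike. The choice \<open>c = - t z\<close> gives the cross term
  the right phase; \<open>t = 1/b\<close> finishes, and for \<open>b = 0\<close> a large
  \<open>t\<close> forces \<open>z = 0\<close>.\<close>

lemma Cauchy_Schwarz_of_form:
  fixes a b :: real and z :: complex
  assumes "\<And>c. 0 \<le> a + (cmod c)\<^sup>2 * b + 2 * Re (cnj c * z)" "0 \<le> a" "0 \<le> b"
  shows "(cmod z)\<^sup>2 \<le> a * b"
proof -
  have key: "2 * t * (cmod z)\<^sup>2 \<le> a + t\<^sup>2 * (cmod z)\<^sup>2 * b" for t :: real
  proof -
    have "Re (cnj (- (of_real t * z)) * z) = - (t * (cmod z)\<^sup>2)"
      by (simp only: cmod_power2) (simp add: algebra_simps power2_eq_square)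
    then show ?thesis using assms(1)[of "- (of_real t * z)"]
      by (simp add: norm_mult power_mult_distrib)
  qed
  show ?thesis
  proof (cases "b = 0")
    case True
    have "(cmod z)\<^sup>2 \<le> 0"
    proof (rule ccontr)
      assume "\<not> ?thesis"
      then have pos: "(cmod z)\<^sup>2 > 0" by simp
      have "2 * ((a + 1) / (cmod z)\<^sup>2) * (cmod z)\<^sup>2 \<le> a"
        using key[of "(a + 1) / (cmod z)\<^sup>2"] True by simp
      then have "2 * (a + 1) \<le> a" using pos by simp
      with assms(2) show False by simp
    qed
    then show ?thesis using True by simp
  next
    case False
    then have b: "b > 0" using assms(3) by simp
    have "2 * (1/b) * (cmod z)\<^sup>2 \<le> a + (1/b)\<^sup>2 * (cmod z)\<^sup>2 * b" by (rule key)
    then have "(cmod z)\<^sup>2 / b \<le> a" using b by (simp add: field_simps power2_eq_square)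
    then show ?thesis using b by (simp add: field_simps)
  qed
qed

lemma cinner_Cauchy_Schwarz: "cmod (cinner x y) \<le> norm x * norm (y::'a::complex_hilbert)"
proof -
  have "(cmod (cinner x y))\<^sup>2 \<le> (norm x)\<^sup>2 * (norm y)\<^sup>2"
  proof (rule Cauchy_Schwarz_of_form)
    fix c
    have "0 \<le> (norm (x + scaleC c y))\<^sup>2" by simp
    also have "\<dots> = (norm x)\<^sup>2 + (cmod c)\<^sup>2 * (norm y)\<^sup>2 + 2 * Re (cnj c * cinner x y)"
      by (simp only: power2_norm_add cinner_scaleC_right norm_scaleC power_mult_distrib)
    finally show "0 \<le> (norm x)\<^sup>2 + (cmod c)\<^sup>2 * (norm y)\<^sup>2 + 2 * Re (cnj c * cinner x y)" .
  qed auto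
  then show ?thesis
    by (metis (no_types, lifting) mult_nonneg_nonneg norm_ge_zero power2_le_imp_le power_mult_distrib)
qed

interpretation cinner: bounded_bilinear "cinner :: 'a::complex_hilbert \<Rightarrow> 'a \<Rightarrow> complex"
proof (standard, goal_cases)
  case 5
  show ?case by (rule exI[of _ 1]) (simp add: cinner_Cauchy_Schwarz)
qed (simp_all add: cinner_add_left cinner_add_right cinner_scaleR_left cinner_scaleR_right scaleR_conv_of_real)

interpretation scaleC: bounded_bilinear "scaleC :: complex \<Rightarrow> 'a::complex_hilbert \<Rightarrow> 'a"
proof (standard, goal_cases)
  case (3 r a b)
  then show ?case by (simp add: scaleR_scaleC scaleC_scaleC scaleR_conv_of_real)
next
  case (4 a r b)
  then show ?case by (simp add: scaleR_scaleC scaleC_scaleC mult.commute)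
next
  case 5
  show ?case by (rule exI[of _ 1]) (simp add: norm_scaleC)
qed (simp_all add: scaleC_add_left scaleC_add_right)

lemma cinner_ext: "(\<And>x. cinner x y = cinner x z) \<Longrightarrow> y = (z::'a::complex_hilbert)"
  by (metis cinner.diff_right cinner_eq_zero_iff eq_iff_diff_eq_0)

lemma cinner_ext_left: "(\<And>x. cinner y x = cinner z x) \<Longrightarrow> y = (z::'a::complex_hilbert)"
  by (metis cinner_ext cinner_commute)

lemma power2_norm_diff:
  "(norm (x - y))\<^sup>2 = (norm x)\<^sup>2 + (norm y)\<^sup>2 - 2 * Re (cinner x (y::'a::complex_hilbert))"
  using power2_norm_add[of x "- y"] by (simp add: cinner.minus_right)

lemma parallelogram_law:
  "(norm (x + y))\<^sup>2 + (norm (x - y))\<^sup>2 = 2 * (norm x)\<^sup>2 + 2 * (norm (y::'a::complex_hilbert))\<^sup>2"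
  by (simp add: power2_norm_diff power2_norm_add)

text \<open>The representing vector minimises \<open>\<parallel>x\<parallel>\<^sup>2 - 2 Re \<phi>(x)\<close>; minimising sequences are Cauchy by
the parallelogram law.\<close>

lemma Riesz_representation:
  fixes \<phi> :: "'a::complex_hilbert \<Rightarrow> complex"
  assumes add: "\<And>x y. \<phi> (x + y) = \<phi> x + \<phi> y"
    and scale: "\<And>c x. \<phi> (scaleC c x) = c * \<phi> x"
    and bd: "\<And>x. cmod (\<phi> x) \<le> K * norm x"
  shows "\<exists>z. \<forall>x. \<phi> x = cinner x z"
proof -
  have lin: "bounded_linear (\<lambda>x. Re (\<phi> x))"
  proof (rule bounded_linear_intro)
    fix x :: 'a
    show "norm (Re (\<phi> x)) \<le> norm x * K"
      using bd[of x] abs_Re_le_cmod[of "\<phi> x"] by (simp add: mult.commute)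
  qed (simp_all add: add scaleR_scaleC scale)
  interpret f: bounded_linear "\<lambda>x. Re (\<phi> x)" by (rule lin)
  define J where "J = (\<lambda>x. (norm x)\<^sup>2 - 2 * Re (\<phi> x))"
  have low: "J x \<ge> - K\<^sup>2" for x
  proof -
    have "Re (\<phi> x) \<le> K * norm x" using bd[of x] complex_Re_le_cmod[of "\<phi> x"] by linarith
    moreover have "0 \<le> (norm x - K)\<^sup>2" by simp
    ultimately show ?thesis unfolding J_def by (simp add: power2_diff algebra_simps)
  qed
  define m where "m = Inf (range J)"
  have bdd: "bdd_below (range J)" using low by (meson bdd_belowI2)
  have m: "m \<le> J x" for x unfolding m_def by (rule cInf_lower[OF _ bdd]) simp
  have "\<exists>x. J x < m + 1 / Suc n" for n
  proof -
    have "Inf (range J) < m + 1 / Suc n" unfolding m_def by simp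
    from cInf_lessD[OF _ this] show ?thesis by auto
  qed
  then obtain X where X: "\<And>n. J (X n) < m + 1 / Suc n" by metis
  have para: "(norm (x - y))\<^sup>2 = 2 * J x + 2 * J y - 4 * J ((1/2) *\<^sub>R (x + y))" for x y
    using parallelogram_law[of x y] unfolding J_def by (simp add: f.scaleR f.add power_divide add_divide_distrib)
  have dist: "(norm (X i - X j))\<^sup>2 \<le> 4 / Suc n" if "i \<ge> n" "j \<ge> n" for i j n
  proof -
    have "1 / real (Suc i) \<le> 1 / real (Suc n)" "1 / real (Suc j) \<le> 1 / real (Suc n)"
      using that by (simp_all add: field_simps)
    then show ?thesis using X[of i] X[of j] m[of "(1/2) *\<^sub>R (X i + X j)"] para[of "X i" "X j"]
      by linarith
  qed
  have "Cauchy X"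
  proof (rule metric_CauchyI)
    fix e :: real assume e: "e > 0"
    obtain n where n: "real (Suc n) > 4 / e\<^sup>2" by (metis reals_Archimedean2 less_trans of_nat_less_iff lessI)
    then have "4 / Suc n < e\<^sup>2" using e by (simp add: field_simps)
    then have "(norm (X i - X j))\<^sup>2 < e\<^sup>2" if "i \<ge> n" "j \<ge> n" for i j
      using dist[OF that] by linarith
    then show "\<exists>M. \<forall>i\<ge>M. \<forall>j\<ge>M. dist (X i) (X j) < e"
      using e by (metis dist_norm power2_less_imp_less less_imp_le)
  qed
  then obtain z where z: "X \<longlonglongrightarrow> z" by (meson Cauchy_convergent convergent_def)
  have "(\<lambda>n. J (X n)) \<longlonglongrightarrow> J z" unfolding J_def
    by (intro tendsto_intros f.tendsto z)
  moreover have "(\<lambda>n. m + 1 / Suc n) \<longlonglongrightarrow> m + 0"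
    by (intro tendsto_intros LIMSEQ_Suc lim_1_over_n)
  ultimately have "J z \<le> m + 0"
    by (rule LIMSEQ_le) (use X less_imp_le in blast)
  then have min: "J z \<le> J x" for x using m[of x] by simp
  \<comment> \<open>Minimality along the real line \<open>z + t h\<close> gives a quadratic in
    \<open>t\<close> that is never negative and has no constant term; its linear coefficient
    \<open>d\<close> must vanish, as \<open>t = - d / s\<close> shows.\<close>
  have Re_eq: "Re (\<phi> h) = Re (cinner h z)" for h
  proof -
    define d where "d = Re (cinner h z) - Re (\<phi> h)"
    have "0 \<le> t\<^sup>2 * (norm h)\<^sup>2 + 2 * t * d" for t :: real
      using min[of "z + t *\<^sub>R h"] unfolding J_def d_def
      by (simp add: power2_norm_add f.add f.scaleR cinner_scaleR_right power_mult_distrib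
          Re_cinner_commute[of h z] algebra_simps)
    note q = this
    have "d = 0"
    proof (rule ccontr)
      assume d: "d \<noteq> 0"
      define s where "s = 1 + (norm h)\<^sup>2"
      have s: "s > 0" unfolding s_def by (smt (verit) zero_le_power2)
      have "0 \<le> (- d / s)\<^sup>2 * (norm h)\<^sup>2 + 2 * (- d / s) * d" by (rule q)
      then have "0 \<le> d\<^sup>2 * ((norm h)\<^sup>2 - 2 * s) / s\<^sup>2"
        using s by (simp add: field_simps power2_eq_square)
      then have "(norm h)\<^sup>2 - 2 * s \<ge> 0" using d s
        by (simp add: zero_le_divide_iff zero_le_mult_iff)
      then show False unfolding s_def by (smt (verit) zero_le_power2)
    qed
    then show ?thesis unfolding d_def by simp
  qed
  have "\<phi> x = cinner x z" for x
  proof (rule complex_eqI)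
    show "Re (\<phi> x) = Re (cinner x z)" by (rule Re_eq)
    \<comment> \<open>The imaginary part of a complex-linear functional at \<open>x\<close> is its
      real part at \<open>scaleC (- \<i>) x\<close>.\<close>
    show "Im (\<phi> x) = Im (cinner x z)"
      using Re_eq[of "scaleC (- \<i>) x"] by (simp add: scale cinner_scaleC_left)
  qed
  then show ?thesis by blast
qed

section \<open>Bounded operators and their adjoints\<close>

lemma bop_bounded_linear: "bop T \<Longrightarrow> bounded_linear T"
  unfolding bop_def by (metis bounded_linear_intro mult.commute scaleR_scaleC)

lemma bop_scaleC: "bop T \<Longrightarrow> T (scaleC c x) = scaleC c (T x)"
  unfolding bop_def by blast

lemma bopI:
  assumes "\<And>x y. T (x + y) = T x + T y" "\<And>c x. T (scaleC c x) = scaleC c (T x)"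
    "\<And>x. norm (T x) \<le> K * norm x"
  shows "bop T"
  unfolding bop_def using assms by blast

lemma bopI_bounded_linear:
  assumes "bounded_linear T" "\<And>c x. T (scaleC c x) = scaleC c (T x)"
  shows "bop T"
  using assms bounded_linear.bounded[OF assms(1)] linear_add[OF bounded_linear.linear[OF assms(1)]]
  unfolding bop_def by (metis mult.commute)

lemmas bop_add = linear_add[OF bounded_linear.linear[OF bop_bounded_linear]]
  and bop_diff = linear_diff[OF bounded_linear.linear[OF bop_bounded_linear]]
  and bop_0 = linear_0[OF bounded_linear.linear[OF bop_bounded_linear]]
  and bop_sum = linear_sum[OF bounded_linear.linear[OF bop_bounded_linear]]
  and bop_scaleR = linear_scale[OF bounded_linear.linear[OF bop_bounded_linear]]
  and bop_onorm = onorm[OF bop_bounded_linear]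
  and bop_onorm_nonneg = onorm_pos_le[OF bop_bounded_linear]

lemma bop_ident: "bop (\<lambda>x. x)"
  by (rule bopI[where K = 1]) auto

lemma bop_zero: "bop (\<lambda>x. 0)"
  by (rule bopI[where K = 0]) (auto simp: scaleC.zero_right)

lemma bop_compose: "bop S \<Longrightarrow> bop T \<Longrightarrow> bop (\<lambda>x. S (T x))"
  by (rule bopI_bounded_linear)
    (auto intro: bounded_linear_compose bop_bounded_linear simp: bop_scaleC)

lemma bop_minus_op: "bop S \<Longrightarrow> bop T \<Longrightarrow> bop (\<lambda>x. S x - T x)"
  by (rule bopI_bounded_linear)
    (auto intro: bounded_linear_sub bop_bounded_linear simp: bop_scaleC scaleC.diff_right)

lemma bop_scaleR_op: "bop T \<Longrightarrow> bop (\<lambda>x. scaleR r (T x))"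
  by (rule bopI_bounded_linear, intro bounded_linear_const_scaleR bop_bounded_linear)
    (auto simp: bop_scaleC scaleR_scaleC scaleC_scaleC mult.commute)

lemma bop_sum_op: "(\<And>i. i \<in> I \<Longrightarrow> bop (T i)) \<Longrightarrow> bop (\<lambda>x. \<Sum>i\<in>I. T i x)"
  by (rule bopI_bounded_linear, rule bounded_linear_sum, rule bop_bounded_linear)
    (auto simp: bop_scaleC scaleC.sum_right)

lemma bop_rank_one: "bop (\<lambda>x. scaleC (cinner x w) v)"
  by (rule bopI_bounded_linear)
    (auto intro: bounded_linear_compose[OF scaleC.bounded_linear_left cinner.bounded_linear_left]
      simp: cinner_scaleC_left scaleC_scaleC)

lemma bop_power: "bop T \<Longrightarrow> bop (T ^^ n)"
  by (induction n) (auto simp: comp_def id_def intro: bop_ident bop_compose)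

text \<open>Riesz supplies the vector behind the \<open>THE\<close> in \<open>adj\<close>, and
  nondegeneracy of the inner product its uniqueness.\<close>

lemma cinner_adj:
  assumes "bop T"
  shows "cinner (T x) y = cinner x (adj T y)"
proof -
  have "\<exists>z. \<forall>x. cinner (T x) y = cinner x z" for y
  proof (rule Riesz_representation)
    fix x
    have "cmod (cinner (T x) y) \<le> norm (T x) * norm y" by (rule cinner_Cauchy_Schwarz)
    also have "\<dots> \<le> (onorm T * norm x) * norm y"
      by (intro mult_right_mono bop_onorm assms) auto
    finally show "cmod (cinner (T x) y) \<le> (onorm T * norm y) * norm x" by (simp add: ac_simps)
  qed (auto simp: assms bop_add bop_scaleC cinner.add_left cinner_scaleC_left)
  then have "\<exists>!z. \<forall>x. cinner (T x) y = cinner x z" by (metis cinner_ext)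
  from theI'[OF this] show ?thesis unfolding adj_def by blast
qed

lemma cinner_adj_left: "bop T \<Longrightarrow> cinner (adj T x) y = cinner x (T y)"
  by (metis cinner_adj cinner_commute)

lemma bop_adj:
  assumes "bop T" shows "bop (adj T)"
proof (rule bopI)
  fix x y c
  show "adj T (x + y) = adj T x + adj T y"
    by (rule cinner_ext_left) (simp add: cinner_adj_left assms cinner.add_left)
  show "adj T (scaleC c x) = scaleC c (adj T x)"
    by (rule cinner_ext_left) (simp add: cinner_adj_left assms cinner_scaleC_left)
  have "(norm (adj T x))\<^sup>2 = Re (cinner x (T (adj T x)))"
    by (simp add: Re_cinner_self[symmetric] cinner_adj_left assms)
  also have "\<dots> \<le> norm x * norm (T (adj T x))"
    by (meson cinner_Cauchy_Schwarz complex_Re_le_cmod order_trans)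
  also have "\<dots> \<le> norm x * (onorm T * norm (adj T x))"
    by (intro mult_left_mono bop_onorm assms) auto
  finally have "norm (adj T x) * norm (adj T x) \<le> (onorm T * norm x) * norm (adj T x)"
    by (simp add: power2_eq_square ac_simps)
  then show "norm (adj T x) \<le> onorm T * norm x"
    by (cases "norm (adj T x) = 0") (use assms in \<open>auto simp: bop_onorm_nonneg\<close>)
qed

subsection \<open>Finite orthogonal projections\<close>

text \<open>Zero vectors are allowed so that every list of \<open>n\<close> vectors can be orthonormalised to a
list of the same length.\<close>

definition ons :: "(nat \<Rightarrow> 'a::complex_hilbert) \<Rightarrow> nat \<Rightarrow> bool" where
  "ons w n \<longleftrightarrow> (\<forall>i<n. \<forall>j<n. i \<noteq> j \<longrightarrow> cinner (w i) (w j) = 0) \<and> (\<forall>i<n. norm (w i) = 1 \<or> w i = 0)"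

definition proj :: "(nat \<Rightarrow> 'a::complex_hilbert) \<Rightarrow> nat \<Rightarrow> 'a \<Rightarrow> 'a" where
  "proj w n x = (\<Sum>i<n. scaleC (cinner x (w i)) (w i))"

lemma bop_proj: "bop (proj w n)"
  unfolding proj_def by (intro bop_sum_op bop_rank_one)

lemma cinner_proj_proj: "cinner (proj w n x) y = cinner x (proj w n y)"
proof -
  have "cinner (w i) y = cnj (cinner y (w i))" for i by (rule cinner_commute)
  then show ?thesis unfolding proj_def
    by (simp add: cinner.sum_left cinner.sum_right cinner_scaleC_left cinner_scaleC_right mult.commute)
qed

lemma cinner_proj:
  assumes "ons w n" "i < n"
  shows "cinner (proj w n x) (w i) = cinner x (w i)"
proof -
  have "cinner (proj w n x) (w i) = (\<Sum>j<n. cinner x (w j) * cinner (w j) (w i))"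
    unfolding proj_def by (simp add: cinner.sum_left cinner_scaleC_left)
  also have "\<dots> = (\<Sum>j\<in>{i}. cinner x (w j) * cinner (w j) (w i))"
    by (rule sum.mono_neutral_right) (use assms in \<open>auto simp: ons_def\<close>)
  also have "\<dots> = cinner x (w i)"
    using assms unfolding ons_def by (auto simp: cinner_self cinner.zero_right)
  finally show ?thesis .
qed

lemma proj_idem: "ons w n \<Longrightarrow> proj w n (proj w n x) = proj w n x"
  unfolding proj_def[of w n "proj w n x"] by (simp add: cinner_proj) (simp add: proj_def)

lemma cinner_perp_proj: "ons w n \<Longrightarrow> cinner (x - proj w n x) (proj w n y) = 0"
  by (simp add: cinner_proj_proj[symmetric] bop_diff[OF bop_proj] proj_idem cinner.zero_left)

lemma pythagoras_proj:
  assumes "ons w n"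
  shows "(norm (x - proj w n y))\<^sup>2 = (norm (x - proj w n x))\<^sup>2 + (norm (proj w n (x - y)))\<^sup>2"
proof -
  have "x - proj w n y = (x - proj w n x) + proj w n (x - y)" by (simp add: bop_diff[OF bop_proj])
  then show ?thesis by (simp only: power2_norm_add cinner_perp_proj[OF assms]) simp
qed

lemma norm_minus_proj_le: "ons w n \<Longrightarrow> norm (x - proj w n x) \<le> norm x"
  using pythagoras_proj[of w n x 0]
  by - (rule power2_le_imp_le; simp add: bop_0[OF bop_proj])

lemma norm_minus_proj_best: "ons w n \<Longrightarrow> norm (x - proj w n x) \<le> norm (x - proj w n y)"
  using pythagoras_proj[of w n x y] by - (rule power2_le_imp_le; simp)

lemma Gram_Schmidt: "\<exists>w. ons w n \<and> (\<forall>i<n. proj w n (v i) = (v i :: 'a::complex_hilbert))"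
proof (induction n)
  case 0
  show ?case by (simp add: ons_def)
next
  case (Suc n)
  then obtain w where w: "ons w n" "\<And>i. i < n \<Longrightarrow> proj w n (v i) = v i" by blast
  define r where "r = v n - proj w n (v n)"
  \<comment> \<open>If \<open>v n\<close> already lies in the span then \<open>r = 0\<close> and a
    zero vector is appended, which \<open>ons\<close> permits.\<close>
  define w' where "w' = w(n := inverse (norm r) *\<^sub>R r)"
  have same: "proj w' n x = proj w n x" for x unfolding proj_def w'_def by (intro sum.cong) auto
  have perp: "cinner r (w i) = 0" "cinner (w i) r = 0" if "i < n" for i
  proof -
    show "cinner r (w i) = 0"
      unfolding r_def by (simp add: cinner.diff_left cinner_proj w(1) that)
    then show "cinner (w i) r = 0" by (metis cinner_commute complex_cnj_zero)
  qed
  have ons': "ons w' (Suc n)"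
    using w(1) perp unfolding ons_def w'_def
    by (auto simp: less_Suc_eq cinner_scaleR_left cinner_scaleR_right)
  have w'n: "w' n = inverse (norm r) *\<^sub>R r" by (simp add: w'_def)
  have step: "proj w' (Suc n) x = proj w n x + scaleC (cinner x (w' n)) (w' n)" for x
    using same[of x] by (simp add: proj_def)
  have fix_old: "proj w' (Suc n) (proj w n x) = proj w n x" for x
  proof -
    have "cinner (proj w n x) r = 0"
      using cinner_perp_proj[OF w(1), of "v n" x] unfolding r_def
      by (metis cinner_commute complex_cnj_zero)
    then show ?thesis
      by (simp add: step proj_idem w(1) w'n cinner_scaleR_right scaleC.zero_left)
  qed
  have fix_r: "proj w' (Suc n) r = r"
  proof (cases "r = 0")
    case True then show ?thesis by (simp add: bop_0[OF bop_proj])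
  next
    case False
    have "proj w n r = 0" unfolding proj_def by (simp add: perp scaleC.zero_left)
    moreover have "cinner r (w' n) = of_real (norm r)"
      using False by (simp add: w'n cinner_scaleR_right cinner_self power2_eq_square)
    ultimately show ?thesis using False by (simp add: step w'n scaleC_of_real)
  qed
  have "proj w' (Suc n) (v i) = v i" if "i < Suc n" for i
  proof (cases "i = n")
    case True
    have "v n = proj w n (v n) + r" by (simp add: r_def)
    then show ?thesis using True by (metis bop_add[OF bop_proj] fix_old fix_r)
  next
    case False
    then show ?thesis using fix_old[of "v i"] w(2)[of i] that by simp
  qed
  with ons' show ?case by blast
qed

subsection \<open>Approximation numbers\<close>

lemma sval_set_bdd_below: "bop X \<Longrightarrow> bdd_below {onorm (\<lambda>x. X x - F x) | F. bop F \<and> rank_le F n}"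
  by (rule bdd_belowI[of _ 0]) (auto intro!: bop_onorm_nonneg bop_minus_op)

lemma rank_le_zero: "rank_le (\<lambda>x. 0) n"
  unfolding rank_le_def by (auto intro!: exI[of _ "\<lambda>_. 0"] simp: scaleC.zero_right)

lemma rank_leI: "(\<And>x. F x = (\<Sum>i<n. scaleC (c x i) (v i))) \<Longrightarrow> rank_le F n"
  unfolding rank_le_def by blast

lemma rank_le_Suc: assumes "rank_le F n" shows "rank_le F (Suc n)"
proof -
  obtain v c where "\<And>x. F x = (\<Sum>i<n. scaleC (c x i) (v i))"
    using assms unfolding rank_le_def by metis
  then have "F x = (\<Sum>i<Suc n. scaleC (if i < n then c x i else 0) (v i))" for x
    by (simp add: scaleC.zero_left)
  then show ?thesis by (rule rank_leI)
qed

lemma rank_le_compose_proj: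
  assumes "bop X" shows "rank_le (\<lambda>x. X (proj w n (Y x))) n"
  by (rule rank_leI[where c = "\<lambda>x i. cinner (Y x) (w i)" and v = "\<lambda>i. X (w i)"])
     (simp add: proj_def bop_sum[OF assms] bop_scaleC[OF assms])

lemma sval_nonneg: "bop X \<Longrightarrow> 0 \<le> sval X n"
  unfolding sval_def
  by (rule cInf_greatest) (auto intro!: bop_onorm_nonneg bop_minus_op intro: bop_zero rank_le_zero)

lemma sval_le:
  assumes "bop X" "bop F" "rank_le F n" "0 \<le> c" "\<And>x. norm (X x - F x) \<le> c * norm x"
  shows "sval X n \<le> c"
proof -
  have "sval X n \<le> onorm (\<lambda>x. X x - F x)"
    unfolding sval_def by (rule cInf_lower[OF _ sval_set_bdd_below]) (use assms in auto)
  also have "\<dots> \<le> c" by (rule onorm_bound) (use assms in auto)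
  finally show ?thesis .
qed

lemma sval_approx:
  assumes "bop X" "sval X n < c"
  obtains F where "bop F" "rank_le F n" "\<And>x. norm (X x - F x) \<le> c * norm x"
proof -
  have "{onorm (\<lambda>x. X x - F x) | F. bop F \<and> rank_le F n} \<noteq> {}"
    using bop_zero rank_le_zero by blast
  from cInf_lessD[OF this assms(2)[unfolded sval_def]]
  obtain F where F: "bop F" "rank_le F n" "onorm (\<lambda>x. X x - F x) < c" by blast
  have "norm (X x - F x) \<le> c * norm x" for x
  proof -
    have "norm (X x - F x) \<le> onorm (\<lambda>x. X x - F x) * norm x"
      by (rule bop_onorm) (intro bop_minus_op assms F)
    also have "\<dots> \<le> c * norm x" using F(3) by (intro mult_right_mono) auto
    finally show ?thesis .
  qed
  with F that show thesis by blast
qed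

lemma sval_antimono: assumes "bop X" shows "antimono (sval X)"
proof (rule decseq_SucI)
  show "sval X (Suc n) \<le> sval X n" for n
    unfolding sval_def
    by (rule cInf_superset_mono[OF _ sval_set_bdd_below])
       (use assms bop_zero rank_le_zero rank_le_Suc in blast)+
qed

text \<open>A near-optimal \<open>F\<close> may be replaced by \<open>proj w n\<close> after
  \<open>X\<close>: orthonormalise vectors spanning the range of \<open>F\<close>; the projection is
  a best approximation, so it loses nothing against \<open>F\<close>.\<close>

lemma sval_range:
  assumes "bop X" "sval X n < c"
  obtains w where "ons w n" "\<And>x. norm (X x - proj w n (X x)) \<le> c * norm x"
proof -
  obtain F where F: "bop F" "rank_le F n" "\<And>x. norm (X x - F x) \<le> c * norm x"
    by (rule sval_approx[OF assms]) (rule that)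
  obtain v a where v: "\<And>x. F x = (\<Sum>i<n. scaleC (a x i) (v i))"
    using F(2) unfolding rank_le_def by metis
  obtain w where w: "ons w n" "\<And>i. i < n \<Longrightarrow> proj w n (v i) = v i"
    using Gram_Schmidt[of n v] by blast
  have "proj w n (F x) = F x" for x
    by (simp add: v bop_sum[OF bop_proj] bop_scaleC[OF bop_proj] w(2))
  then have "norm (X x - proj w n (X x)) \<le> c * norm x" for x
    using norm_minus_proj_best[OF w(1), of "X x" "F x"] F(3)[of x] by simp
  with w(1) that show thesis by blast
qed

lemma sval_le_range:
  assumes "bop X" "0 \<le> c" "\<And>x. norm (X x - proj w n (X x)) \<le> c * norm x"
  shows "sval X n \<le> c"
  by (rule sval_le[OF assms(1) bop_compose[OF bop_proj assms(1)] _ assms(2,3)])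
     (rule rank_le_compose_proj[OF bop_ident])

text \<open>Dual description: \<open>X\<close> is small on a subspace of codimension at most
  \<open>n\<close>. The constraints are the pullbacks \<open>adj X (w i)\<close> of an orthonormal
  list for the approximating range, so that \<open>X u\<close> has zero projection there.\<close>

lemma sval_ker:
  assumes "bop X" "sval X n < c"
  shows "\<exists>w. \<forall>u. (\<forall>i<n. cinner u (w i) = 0) \<longrightarrow> norm (X u) \<le> c * norm u"
proof -
  obtain w where w: "ons w n" "\<And>x. norm (X x - proj w n (X x)) \<le> c * norm x"
    by (rule sval_range[OF assms]) (rule that)
  have "norm (X u) \<le> c * norm u" if "\<forall>i<n. cinner u (adj X (w i)) = 0" for u
  proof -
    have "proj w n (X u) = 0"
      unfolding proj_def by (simp add: cinner_adj assms(1) that scaleC.zero_left)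
    then show ?thesis using w(2)[of u] by simp
  qed
  then show ?thesis by (intro exI[of _ "\<lambda>i. adj X (w i)"]) blast
qed

text \<open>Converse of \<open>sval_ker\<close>: the approximant is \<open>X\<close> after the
  projection onto a span containing the constraint vectors.\<close>

lemma sval_le_ker:
  assumes "bop X" "0 \<le> c"
    and "\<And>u. (\<And>i. i < n \<Longrightarrow> cinner u (w i) = 0) \<Longrightarrow> norm (X u) \<le> c * norm u"
  shows "sval X n \<le> c"
proof -
  obtain w' where w': "ons w' n" "\<And>i. i < n \<Longrightarrow> proj w' n (w i) = w i"
    using Gram_Schmidt[of n w] by blast
  show ?thesis
  proof (rule sval_le[OF assms(1) bop_compose[OF assms(1) bop_proj[of w' n]]])
    show "rank_le (\<lambda>x. X (proj w' n x)) n" by (rule rank_le_compose_proj[OF assms(1)])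
    fix x
    have "norm (X (x - proj w' n x)) \<le> c * norm (x - proj w' n x)"
    proof (rule assms(3))
      show "cinner (x - proj w' n x) (w i) = 0" if "i < n" for i
        using cinner_perp_proj[OF w'(1), of x "w i"] w'(2)[OF that] by simp
    qed
    also have "\<dots> \<le> c * norm x" by (intro mult_left_mono norm_minus_proj_le w' assms)
    finally show "norm (X x - X (proj w' n x)) \<le> c * norm x" by (simp add: bop_diff assms(1))
  qed fact
qed

text \<open>Approximation numbers are governed by pointwise bounds on subspaces of finite
  codimension, so any rule turning a bound for \<open>norm (X u)\<close> into one for
  \<open>norm (Y u)\<close> passes to them. Continuity of \<open>f\<close> lets \<open>c\<close>
  decrease to \<open>sval X n\<close>, as \<open>sval_ker\<close> asks for a strict
  inequality.\<close>

lemma sval_mono_fun: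
  assumes "bop X" "bop Y" "\<And>c. 0 \<le> c \<Longrightarrow> isCont f c" "\<And>c. 0 \<le> c \<Longrightarrow> 0 \<le> f c"
    and "\<And>u c. 0 \<le> c \<Longrightarrow> norm (X u) \<le> c * norm u \<Longrightarrow> norm (Y u) \<le> f c * norm u"
  shows "sval Y n \<le> f (sval X n)"
proof -
  have *: "sval Y n \<le> f c" if lt: "sval X n < c" for c
  proof -
    have c: "0 \<le> c" using sval_nonneg[OF assms(1), of n] lt by linarith
    obtain w where "\<forall>u. (\<forall>i<n. cinner u (w i) = 0) \<longrightarrow> norm (X u) \<le> c * norm u"
      using sval_ker[OF assms(1) lt] by blast
    then show ?thesis using c assms by (intro sval_le_ker[where w = w]) blast+
  qed
  have s: "0 \<le> sval X n" by (rule sval_nonneg[OF assms(1)])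
  have "(\<lambda>k. f (sval X n + 1 / Suc k)) \<longlonglongrightarrow> f (sval X n + 0)"
    by (intro isCont_tendsto_compose[OF assms(3)] tendsto_intros LIMSEQ_Suc lim_1_over_n)
       (use s in auto)
  from LIMSEQ_le_const[OF this, of "sval Y n"] show ?thesis using * by fastforce
qed

lemma sval_le_if_norm_le:
  assumes "bop X" "bop Y" "0 \<le> K" "\<And>u. norm (Y u) \<le> K * norm (X u)"
  shows "sval Y n \<le> K * sval X n"
proof (rule sval_mono_fun[OF assms(1,2)])
  fix u c assume "0 \<le> (c::real)" "norm (X u) \<le> c * norm u"
  then have "K * norm (X u) \<le> K * (c * norm u)" using assms(3) by (intro mult_left_mono)
  then show "norm (Y u) \<le> K * c * norm u" using assms(4)[of u] by simp
qed (use assms(3) in \<open>auto\<close>)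

lemma sval_cong_norm:
  assumes "bop X" "bop Y" "\<And>u. norm (Y u) = norm (X u)"
  shows "sval Y n = sval X n"
  using sval_le_if_norm_le[of X Y 1 n] sval_le_if_norm_le[of Y X 1 n] assms by force

lemma sval_scaleR:
  assumes "bop X" "0 < r" shows "sval (\<lambda>x. r *\<^sub>R X x) n = r * sval X n"
proof (rule antisym)
  show "sval (\<lambda>x. r *\<^sub>R X x) n \<le> r * sval X n"
    by (rule sval_le_if_norm_le) (use assms bop_scaleR_op in auto)
  have "sval X n \<le> inverse r * sval (\<lambda>x. r *\<^sub>R X x) n"
    by (rule sval_le_if_norm_le) (use assms bop_scaleR_op in \<open>auto simp: field_simps\<close>)
  then show "r * sval X n \<le> sval (\<lambda>x. r *\<^sub>R X x) n" using assms(2) by (simp add: field_simps)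
qed

text \<open>With \<open>p\<close> the projection from \<open>sval_range\<close> and
  \<open>S = P - p P\<close>, the operator \<open>P P - P p P\<close> is the adjoint of
  \<open>S\<close> times \<open>S\<close>, of norm at most \<open>c^2\<close>, while
  \<open>P p P\<close> has rank at most \<open>n\<close>.\<close>

lemma sval_selfadjoint_square:
  assumes "bop P" "\<And>x y. cinner (P x) y = cinner x (P y)"
  shows "sval (\<lambda>x. P (P x)) n \<le> (sval P n)\<^sup>2"
proof -
  have *: "sval (\<lambda>x. P (P x)) n \<le> c\<^sup>2" if lt: "sval P n < c" for c
  proof -
    have c: "0 \<le> c" using sval_nonneg[OF assms(1), of n] lt by linarith
    obtain w where w: "ons w n" "\<And>x. norm (P x - proj w n (P x)) \<le> c * norm x"
      by (rule sval_range[OF assms(1) lt]) (rule that)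
    show ?thesis
    proof (rule sval_le[OF bop_compose[OF assms(1,1)] bop_compose[OF assms(1) bop_compose[OF bop_proj assms(1)]]
          rank_le_compose_proj[OF assms(1)]])
      fix x
      define y where "y = P (P x) - P (proj w n (P x))"
      have "(norm y)\<^sup>2 = Re (cinner (P (P x - proj w n (P x))) y)"
        by (simp add: y_def Re_cinner_self bop_diff assms(1))
      also have "\<dots> = Re (cinner (P x - proj w n (P x)) (P y - proj w n (P y)))"
        by (simp add: assms(2) cinner.diff_right cinner_perp_proj w(1))
      also have "\<dots> \<le> norm (P x - proj w n (P x)) * norm (P y - proj w n (P y))"
        by (meson cinner_Cauchy_Schwarz complex_Re_le_cmod order_trans)
      also have "\<dots> \<le> (c * norm x) * (c * norm y)"
        by (intro mult_mono w) (use c in auto)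
      finally have "norm y * norm y \<le> (c\<^sup>2 * norm x) * norm y" by (simp add: power2_eq_square ac_simps)
      then show "norm (P (P x) - P (proj w n (P x))) \<le> c\<^sup>2 * norm x"
        unfolding y_def[symmetric] by (cases "norm y = 0") auto
    qed simp
  qed
  have "(\<lambda>k. (sval P n + 1 / Suc k)\<^sup>2) \<longlonglongrightarrow> (sval P n + 0)\<^sup>2"
    by (intro tendsto_intros LIMSEQ_Suc lim_1_over_n)
  from LIMSEQ_le_const[OF this, of "sval (\<lambda>x. P (P x)) n"] show ?thesis using * by fastforce
qed

subsection \<open>Fractional powers of positive operators\<close>

text \<open>Coefficient of \<open>r^k\<close> in the binomial series of \<open>(1 - r)^t\<close>,
  sign included.\<close>

definition bcoeff :: "real \<Rightarrow> nat \<Rightarrow> real" where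
  "bcoeff t k = (-1) ^ k * (t gchoose k)"

lemma bcoeff_Vandermonde: "(\<Sum>i\<le>n. bcoeff s i * bcoeff t (n - i)) = bcoeff (s + t) n"
proof -
  have "(\<Sum>i\<le>n. bcoeff s i * bcoeff t (n - i)) = (\<Sum>i\<le>n. (-1) ^ n * ((s gchoose i) * (t gchoose (n - i))))"
  proof (rule sum.cong)
    fix i assume "i \<in> {..n}"
    then have "(-1::real) ^ n = (-1) ^ i * (-1) ^ (n - i)" by (simp add: power_add[symmetric])
    then show "bcoeff s i * bcoeff t (n - i) = (-1) ^ n * ((s gchoose i) * (t gchoose (n - i)))"
      by (simp add: bcoeff_def)
  qed simp
  also have "\<dots> = bcoeff (s + t) n"
    using gbinomial_Vandermonde[of s t n]
    by (simp add: sum_distrib_left[symmetric] bcoeff_def atLeast0AtMost)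
  finally show ?thesis .
qed

text \<open>Telescoping: \<open>t |\<beta>\<^sub>k| = k |\<beta>\<^sub>k| - (k + 1) |\<beta>\<^sub>k\<^sub>+\<^sub>1|\<close> as soon as \<open>k \<ge> t\<close>.\<close>

lemma sum_abs_bcoeff:
  assumes "0 < t" "t \<le> real m"
  shows "(\<Sum>k<n. t * \<bar>bcoeff t (k + m)\<bar>) \<le> real m * \<bar>bcoeff t m\<bar>"
proof -
  have "(\<Sum>k<n. t * \<bar>bcoeff t (k + m)\<bar>) = real m * \<bar>bcoeff t m\<bar> - real (n + m) * \<bar>bcoeff t (n + m)\<bar>"
  proof (induction n)
    case (Suc n)
    let ?k = "n + m"
    have "(real ?k + 1) * (t gchoose Suc ?k) = (t - real ?k) * (t gchoose ?k)"
      using gbinomial_mult_1[of t ?k] by (simp add: algebra_simps)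
    then have "(real ?k + 1) * \<bar>t gchoose Suc ?k\<bar> = \<bar>t - real ?k\<bar> * \<bar>t gchoose ?k\<bar>"
      by (metis abs_mult abs_of_nonneg of_nat_0_le_iff add_nonneg_nonneg zero_le_one)
    moreover have "\<bar>t - real ?k\<bar> = real ?k - t" using assms(2) by simp
    ultimately have "t * \<bar>bcoeff t ?k\<bar> = real ?k * \<bar>bcoeff t ?k\<bar> - (real ?k + 1) * \<bar>bcoeff t (Suc ?k)\<bar>"
      by (simp add: bcoeff_def abs_mult algebra_simps)
    then show ?case using Suc by (simp add: algebra_simps)
  qed simp
  then show ?thesis by simp
qed

text \<open>Beyond an integer \<open>m >= t\<close> the telescoping bounds all partial sums. The
  exponent \<open>0\<close> is separate because the telescoped sums carry a factor
  \<open>t\<close>.\<close>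

lemma summable_bcoeff:
  assumes "0 \<le> t" shows "summable (\<lambda>k. \<bar>bcoeff t k\<bar>)"
proof (cases "t = 0")
  case True
  then show ?thesis
    by (intro summable_finite[of "{0}"]) (auto simp: bcoeff_def gbinomial_0_left)
next
  case False
  then have t: "0 < t" using assms by simp
  obtain m where m: "t \<le> real m" using real_arch_simple by blast
  have "summable (\<lambda>k. t * \<bar>bcoeff t (k + m)\<bar>)"
    by (rule summableI_nonneg_bounded) (use t sum_abs_bcoeff[OF t m] in auto)
  then have "summable (\<lambda>k. \<bar>bcoeff t (k + m)\<bar>)"
    using t summable_mult[of _ "1/t"] by fastforce
  then show ?thesis by (rule summable_iff_shift[of "\<lambda>k. \<bar>bcoeff t k\<bar>" m, THEN iffD1])
qed

text \<open>Telescoping from \<open>m = 1\<close>, possible as \<open>t <= 1\<close>, bounds the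
  tail by \<open>1\<close>; the head is \<open>1\<close>. The bound is uniform in \<open>t\<close>,
  which later absorbs fractional parts of exponents.\<close>

lemma suminf_bcoeff_le:
  assumes "0 \<le> t" "t \<le> 1" shows "(\<Sum>k. \<bar>bcoeff t k\<bar>) \<le> 2"
proof -
  have s: "summable (\<lambda>k. \<bar>bcoeff t (Suc k)\<bar>)"
    using summable_bcoeff[OF assms(1)] by (subst summable_Suc_iff)
  have "(\<Sum>k<n. \<bar>bcoeff t (Suc k)\<bar>) \<le> 1" for n
  proof (cases "t = 0")
    case True then show ?thesis by (simp add: bcoeff_def)
  next
    case False
    then have "t * (\<Sum>k<n. \<bar>bcoeff t (Suc k)\<bar>) \<le> t * 1"
      using sum_abs_bcoeff[of t 1 n] assms by (simp add: bcoeff_def sum_distrib_left)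
    then show ?thesis using False assms by simp
  qed
  then have "(\<Sum>k. \<bar>bcoeff t (Suc k)\<bar>) \<le> 1" by (intro suminf_le_const s)
  then show ?thesis
    using suminf_split_head[OF summable_bcoeff[OF assms(1)]] by (simp add: bcoeff_def)
qed

section \<open>Binomial series of a selfadjoint contraction\<close>

locale selfadjoint_contraction =
  fixes R :: "'a::complex_hilbert \<Rightarrow> 'a"
  assumes bop: "bop R"
    and selfadjoint: "cinner (R x) y = cinner x (R y)"
    and contraction: "norm (R x) \<le> norm x"
begin

text \<open>\<open>pw t = (I - R)\<^sup>t\<close>\<close>

definition pw :: "real \<Rightarrow> 'a \<Rightarrow> 'a" where
  "pw t x = (\<Sum>k. bcoeff t k *\<^sub>R (R ^^ k) x)"

lemma norm_funpow_le: "norm ((R ^^ k) x) \<le> norm x"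
  by (induction k) (auto intro: order_trans[OF contraction])

lemma summable_norm_pw:
  assumes "0 \<le> t" shows "summable (\<lambda>k. norm (bcoeff t k *\<^sub>R (R ^^ k) x))"
proof (rule summable_comparison_test')
  show "summable (\<lambda>k. \<bar>bcoeff t k\<bar> * norm x)"
    by (rule summable_mult2[OF summable_bcoeff[OF assms]])
qed (auto intro!: mult_left_mono norm_funpow_le)

lemma summable_pw: "0 \<le> t \<Longrightarrow> summable (\<lambda>k. bcoeff t k *\<^sub>R (R ^^ k) x)"
  by (rule summable_norm_cancel[OF summable_norm_pw])

lemma norm_pw_le: assumes "0 \<le> t" shows "norm (pw t x) \<le> (\<Sum>k. \<bar>bcoeff t k\<bar>) * norm x"
proof -
  have "norm (pw t x) \<le> (\<Sum>k. norm (bcoeff t k *\<^sub>R (R ^^ k) x))"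
    unfolding pw_def by (rule summable_norm[OF summable_norm_pw[OF assms]])
  also have "\<dots> \<le> (\<Sum>k. \<bar>bcoeff t k\<bar> * norm x)"
    by (intro suminf_le summable_norm_pw summable_mult2 summable_bcoeff assms)
       (auto intro!: mult_left_mono norm_funpow_le)
  also have "\<dots> = (\<Sum>k. \<bar>bcoeff t k\<bar>) * norm x"
    by (rule suminf_mult2[symmetric, OF summable_bcoeff[OF assms]])
  finally show ?thesis .
qed

lemma norm_pw_le_2: "0 \<le> t \<Longrightarrow> t \<le> 1 \<Longrightarrow> norm (pw t x) \<le> 2 * norm x"
  by (rule order_trans[OF norm_pw_le mult_right_mono[OF suminf_bcoeff_le]]) auto

lemma bop_pw: assumes "0 \<le> t" shows "bop (pw t)"
proof (rule bopI[OF _ _ norm_pw_le[OF assms]])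
  note Rk = bop_power[OF bop]
  fix x y c
  show "pw t (x + y) = pw t x + pw t y" unfolding pw_def
    by (simp add: bop_add[OF Rk] scaleR_add_right suminf_add summable_pw assms)
  have "scaleC c (pw t x) = (\<Sum>k. scaleC c (bcoeff t k *\<^sub>R (R ^^ k) x))" unfolding pw_def
    by (rule bounded_linear.suminf[OF scaleC.bounded_linear_right summable_pw[OF assms]])
  then show "pw t (scaleC c x) = scaleC c (pw t x)" unfolding pw_def
    by (simp add: bop_scaleC[OF Rk] scaleR_scaleC scaleC_scaleC mult.commute)
qed

lemma pw_selfadjoint:
  assumes "0 \<le> t" shows "cinner (pw t x) y = cinner x (pw t y)"
proof -
  have Rk: "cinner ((R ^^ k) x) y = cinner x ((R ^^ k) y)" for k x y
    by (induction k arbitrary: x y) (simp_all add: selfadjoint funpow_swap1)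
  have "cinner (pw t x) y = (\<Sum>k. cinner (bcoeff t k *\<^sub>R (R ^^ k) x) y)" unfolding pw_def
    by (rule bounded_linear.suminf[OF cinner.bounded_linear_left summable_pw[OF assms]])
  also have "\<dots> = (\<Sum>k. cinner x (bcoeff t k *\<^sub>R (R ^^ k) y))"
    by (simp add: cinner_scaleR_left cinner_scaleR_right Rk)
  also have "\<dots> = cinner x (pw t y)" unfolding pw_def
    by (rule bounded_linear.suminf[OF cinner.bounded_linear_right summable_pw[OF assms], symmetric])
  finally show ?thesis .
qed

lemma pw_1: "pw 1 x = x - R x"
proof -
  have "pw 1 x = (\<Sum>k<2. bcoeff 1 k *\<^sub>R (R ^^ k) x)" unfolding pw_def
  proof (rule suminf_finite)
    fix k :: nat assume "k \<notin> {..<2}"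
    then have "(1::real) gchoose k = 0"
      using binomial_gbinomial[of 1 k, where 'a = real] by (simp add: binomial_eq_0)
    then show "bcoeff 1 k *\<^sub>R (R ^^ k) x = 0" by (simp add: bcoeff_def)
  qed simp
  then show ?thesis by (simp add: bcoeff_def numeral_2_eq_2)
qed

lemma pw_0: "pw 0 x = x"
proof -
  have "pw 0 x = (\<Sum>k<1. bcoeff 0 k *\<^sub>R (R ^^ k) x)" unfolding pw_def
    by (rule suminf_finite) (auto simp: bcoeff_def gbinomial_0_left)
  then show ?thesis by (simp add: bcoeff_def)
qed

text \<open>Cauchy product: the double series converges absolutely, because powers of
  \<open>R\<close> do not increase norms, so it may be regrouped along \<open>i + j = n\<close>,
  where \<open>bcoeff_Vandermonde\<close> collapses the inner sum.\<close>

lemma pw_pw: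
  assumes "0 \<le> s" "0 \<le> t" shows "pw s (pw t x) = pw (s + t) x"
proof -
  have has_pw: "((\<lambda>k. bcoeff t k *\<^sub>R (R ^^ k) x) has_sum pw t x) UNIV" if "0 \<le> t" for t x
    unfolding pw_def
    by (rule norm_summable_imp_has_sum[OF summable_norm_pw[OF that] summable_sums[OF summable_pw[OF that]]])
  note inf_pw = infsumI[OF has_pw]
  define f where "f = (\<lambda>(i, j). (bcoeff s i * bcoeff t j) *\<^sub>R (R ^^ (i + j)) x)"
  have sumb: "(\<lambda>k. \<bar>bcoeff r k\<bar>) summable_on UNIV" if "0 \<le> r" for r
    by (rule norm_summable_imp_summable_on) (use summable_bcoeff[OF that] in simp)
  have "(\<lambda>p. norm (case p of (i, j) \<Rightarrow> bcoeff s i * bcoeff t j)) summable_on UNIV \<times> UNIV"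
    by (subst Infinite_Sum.abs_summable_on_Sigma_iff)
       (auto simp: abs_mult infsum_cmult_right' intro!: summable_on_cmult_right summable_on_cmult_left
         sumb assms infsum_nonneg mult_nonneg_nonneg)
  then have "(\<lambda>p. norm (f p)) summable_on UNIV \<times> UNIV"
    by (rule Infinite_Sum.abs_summable_on_comparison_test'[OF summable_on_cmult_left[where c = "norm x"]])
       (auto simp: f_def abs_mult intro!: mult_left_mono norm_funpow_le)
  then have f: "f summable_on UNIV \<times> UNIV" by (rule Infinite_Sum.abs_summable_summable)
  have "pw s (pw t x) = (\<Sum>\<^sub>\<infinity>i. bcoeff s i *\<^sub>R (R ^^ i) (pw t x))" by (simp add: inf_pw assms)
  also have "\<dots> = (\<Sum>\<^sub>\<infinity>i. \<Sum>\<^sub>\<infinity>j. f (i, j))"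
  proof (rule infsum_cong)
    fix i
    have bl: "bounded_linear (\<lambda>y. bcoeff s i *\<^sub>R (R ^^ i) y)"
      by (intro bounded_linear_const_scaleR bop_bounded_linear bop_power bop)
    have "bcoeff s i *\<^sub>R (R ^^ i) (pw t x) = (\<Sum>\<^sub>\<infinity>j. bcoeff s i *\<^sub>R (R ^^ i) (bcoeff t j *\<^sub>R (R ^^ j) x))"
      by (rule infsumI[OF has_sum_bounded_linear[OF bl has_pw[OF assms(2)]], symmetric])
    also have "\<dots> = (\<Sum>\<^sub>\<infinity>j. f (i, j))"
      by (simp add: f_def bop_scaleR[OF bop_power[OF bop]] funpow_add)
    finally show "bcoeff s i *\<^sub>R (R ^^ i) (pw t x) = (\<Sum>\<^sub>\<infinity>j. f (i, j))" .
  qed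
  also have "\<dots> = infsum f (UNIV \<times> UNIV)" by (rule infsum_Sigma_banach[OF f])
  also have "\<dots> = infsum (\<lambda>(n, i). f (i, n - i)) (SIGMA n:UNIV. {..n})"
    by (rule infsum_reindex_bij_witness[of _ "\<lambda>(n, i). (i, n - i)" "\<lambda>(i, j). (i + j, i)"])
       auto
  also have "\<dots> = (\<Sum>\<^sub>\<infinity>n. \<Sum>\<^sub>\<infinity>i\<in>{..n}. f (i, n - i))"
  proof (rule infsum_Sigma'_banach[symmetric])
    show "(\<lambda>(n, i). f (i, n - i)) summable_on (SIGMA n:UNIV. {..n})"
      by (rule summable_on_reindex_bij_witness[of _ "\<lambda>(i, j). (i + j, i)" "\<lambda>(n, i). (i, n - i)" _ f, THEN iffD2])
         (use f in auto)
  qed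
  also have "\<dots> = (\<Sum>\<^sub>\<infinity>n. bcoeff (s + t) n *\<^sub>R (R ^^ n) x)"
  proof (rule infsum_cong)
    fix n
    have "(\<Sum>i\<le>n. f (i, n - i)) = (\<Sum>i\<le>n. (bcoeff s i * bcoeff t (n - i)) *\<^sub>R (R ^^ n) x)"
      by (rule sum.cong) (auto simp: f_def)
    also have "\<dots> = bcoeff (s + t) n *\<^sub>R (R ^^ n) x"
      by (simp add: scaleR_sum_left[symmetric] bcoeff_Vandermonde)
    finally show "(\<Sum>\<^sub>\<infinity>i\<in>{..n}. f (i, n - i)) = bcoeff (s + t) n *\<^sub>R (R ^^ n) x" by simp
  qed
  also have "\<dots> = pw (s + t) x" by (rule inf_pw) (use assms in simp)
  finally show ?thesis .
qed

end

section \<open>Approximation numbers of fractional powers\<close>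

context selfadjoint_contraction
begin

text \<open>The upper bound is \<open>sval_selfadjoint_square\<close>; the lower one transfers
  \<open>(norm (pw t u))^2 <= norm (pw (2 * t) u) * norm u\<close>, which comes from moving one
  factor \<open>pw t\<close> across the inner product.\<close>

lemma sval_pw_double:
  assumes "0 \<le> t" shows "sval (pw (2 * t)) n = (sval (pw t) n)\<^sup>2"
proof (rule antisym)
  have eq: "pw (2 * t) = (\<lambda>x. pw t (pw t x))"
    by (simp add: fun_eq_iff pw_pw assms)
  show "sval (pw (2 * t)) n \<le> (sval (pw t) n)\<^sup>2"
    unfolding eq by (rule sval_selfadjoint_square[OF bop_pw[OF assms] pw_selfadjoint[OF assms]])
  have "sval (pw t) n \<le> sqrt (sval (pw (2 * t)) n)"
  proof (rule sval_mono_fun)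
    fix u c assume c: "0 \<le> c" "norm (pw (2 * t) u) \<le> c * norm u"
    have "(norm (pw t u))\<^sup>2 = Re (cinner (pw (2 * t) u) u)"
      by (simp add: eq Re_cinner_self[symmetric] pw_selfadjoint assms)
    also have "\<dots> \<le> norm (pw (2 * t) u) * norm u"
      by (meson cinner_Cauchy_Schwarz complex_Re_le_cmod order_trans)
    also have "\<dots> \<le> (c * norm u) * norm u" using c by (intro mult_right_mono) auto
    also have "\<dots> = (sqrt c * norm u)\<^sup>2" using c by (simp add: power_mult_distrib power2_eq_square)
    finally show "norm (pw t u) \<le> sqrt c * norm u" by (rule power2_le_imp_le) (use c in auto)
  qed (use assms in \<open>auto intro!: bop_pw isCont_real_sqrt\<close>)
  then have "(sval (pw t) n)\<^sup>2 \<le> (sqrt (sval (pw (2 * t)) n))\<^sup>2"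
    by (rule power_mono) (rule sval_nonneg[OF bop_pw[OF assms]])
  then show "(sval (pw t) n)\<^sup>2 \<le> sval (pw (2 * t)) n"
    using sval_nonneg[OF bop_pw] assms by simp
qed

lemma sval_pw_power2:
  assumes "0 \<le> t" shows "sval (pw (2 ^ m * t)) n = sval (pw t) n ^ 2 ^ m"
proof (induction m)
  case (Suc m)
  have "sval (pw (2 ^ Suc m * t)) n = (sval (pw (2 ^ m * t)) n)\<^sup>2"
    using sval_pw_double[of "2 ^ m * t"] assms by (simp add: mult.assoc)
  also have "\<dots> = sval (pw t) n ^ 2 ^ Suc m"
    unfolding Suc by (simp only: power_mult[symmetric] power_Suc mult.commute)
  finally show ?case .
qed simp

text \<open>The moments \<open>\<parallel>(I - R)\<^sup>k u\<parallel>\<close> are log-convex in \<open>k\<close>.\<close>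

lemma norm_pw_power_le:
  "norm (pw (real N) u) ^ Suc N \<le> norm (pw (real (Suc N)) u) ^ N * norm u"
proof (induction N)
  case 0 then show ?case by (simp add: pw_0)
next
  case (Suc N)
  let ?g = "\<lambda>k. norm (pw (real k) u)"
  \<comment> \<open>One factor \<open>I - R\<close> moves across the inner product, splitting
    \<open>2 (N + 1)\<close> as \<open>N + (N + 2)\<close>.\<close>
  have "(?g (Suc N))\<^sup>2 = Re (cinner (pw (real N) u) (pw (real (Suc (Suc N))) u))"
    by (simp add: Re_cinner_self[symmetric] pw_selfadjoint[symmetric] pw_pw)
       (simp add: pw_selfadjoint pw_pw add.commute)
  also have "\<dots> \<le> ?g N * ?g (Suc (Suc N))"
    by (meson cinner_Cauchy_Schwarz complex_Re_le_cmod order_trans)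
  finally have *: "(?g (Suc N))\<^sup>2 \<le> ?g N * ?g (Suc (Suc N))" .
  show ?case
  proof (cases "?g (Suc N) = 0")
    case True then show ?thesis by simp
  next
    case False
    have "((?g (Suc N))\<^sup>2) ^ Suc N \<le> (?g N * ?g (Suc (Suc N))) ^ Suc N"
      by (rule power_mono[OF *]) simp
    also have "\<dots> = ?g N ^ Suc N * ?g (Suc (Suc N)) ^ Suc N" by (rule power_mult_distrib)
    also have "\<dots> \<le> (?g (Suc N) ^ N * norm u) * ?g (Suc (Suc N)) ^ Suc N"
      by (rule mult_right_mono[OF Suc]) simp
    finally have "?g (Suc N) ^ N * ?g (Suc N) ^ Suc (Suc N)
        \<le> ?g (Suc N) ^ N * (?g (Suc (Suc N)) ^ Suc N * norm u)"
      by (simp add: power_mult[symmetric] power_add[symmetric] mult_2 mult_2_right ac_simps)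
    then show ?thesis by (rule mult_left_le_imp_le) (use False in simp)
  qed
qed

lemma sval_pw_consecutive: "sval (pw (real N)) n ^ Suc N \<le> sval (pw (real (Suc N))) n ^ N"
proof -
  have "sval (pw (real N)) n \<le> root (Suc N) (sval (pw (real (Suc N))) n ^ N)"
  proof (rule sval_mono_fun)
    fix u c assume c: "0 \<le> c" "norm (pw (real (Suc N)) u) \<le> c * norm u"
    have "norm (pw (real N) u) ^ Suc N \<le> (c * norm u) ^ N * norm u"
      by (rule order_trans[OF norm_pw_power_le mult_right_mono[OF power_mono[OF c(2)]]]) auto
    also have "\<dots> = (root (Suc N) (c ^ N) * norm u) ^ Suc N"
      using c(1) by (simp only: power_mult_distrib real_root_pow_pos2 zero_less_Suc zero_le_power)
        (simp add: ac_simps)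
    finally show "norm (pw (real N) u) \<le> root (Suc N) (c ^ N) * norm u"
      by (rule power_le_imp_le_base) (use c in auto)
  qed (auto intro!: bop_pw continuous_intros)
  then have "sval (pw (real N)) n ^ Suc N \<le> root (Suc N) (sval (pw (real (Suc N))) n ^ N) ^ Suc N"
    by (rule power_mono) (simp add: sval_nonneg bop_pw)
  then show ?thesis by (simp only: real_root_pow_pos2 zero_less_Suc zero_le_power sval_nonneg bop_pw of_nat_0_le_iff)
qed

text \<open>Root-free form of the statement that the \<open>N\<close>-th root of
  \<open>sval (pw (real N)) n\<close> is nondecreasing in \<open>N >= 1\<close>. Consecutive
  comparisons are chained after raising to the power \<open>L\<close>, which is cancelled at the
  end.\<close>

lemma sval_pw_nat_mono:
  assumes "N \<le> L" "1 \<le> N"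
  shows "sval (pw (real N)) n ^ L \<le> sval (pw (real L)) n ^ N"
  using assms
proof (induction L rule: dec_induct)
  case (step L)
  let ?s = "\<lambda>k. sval (pw (real k)) n"
  have nn: "0 \<le> ?s k" for k by (simp add: sval_nonneg bop_pw)
  obtain L' where L': "L = Suc L'" using step by (cases L) auto
  have "(?s N ^ Suc L) ^ L = (?s N ^ L) ^ Suc L"
    by (simp only: power_mult[symmetric] mult.commute)
  also have "\<dots> \<le> (?s L ^ N) ^ Suc L" by (rule power_mono) (use step nn in auto)
  also have "\<dots> = (?s L ^ Suc L) ^ N"
    by (simp only: power_mult[symmetric] mult.commute)
  also have "\<dots> \<le> (?s (Suc L) ^ L) ^ N"
    by (rule power_mono[OF sval_pw_consecutive]) (use nn in simp)
  also have "\<dots> = (?s (Suc L) ^ N) ^ L"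
    by (simp only: power_mult[symmetric] mult.commute)
  finally show ?case unfolding L' by (rule power_le_imp_le_base) (rule zero_le_power, rule nn)
qed simp

text \<open>The nondecreasing roots of \<open>sval_pw_nat_mono\<close> agree at the exponents
  \<open>1\<close> and \<open>2 ^ N\<close> by \<open>sval_pw_power2\<close>; since
  \<open>N < 2 ^ N\<close>, the root at \<open>N\<close> is squeezed between them.\<close>

lemma sval_pw_nat:
  assumes "1 \<le> N" shows "sval (pw (real N)) n = sval (pw 1) n ^ N"
proof (rule antisym)
  let ?s = "\<lambda>k. sval (pw (real k)) n"
  have nn: "0 \<le> ?s k" for k by (simp add: sval_nonneg bop_pw)
  show "sval (pw 1) n ^ N \<le> ?s N" using sval_pw_nat_mono[of 1 N n] assms by simp
  have "?s N ^ 2 ^ N \<le> ?s (2 ^ N) ^ N"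
    by (rule sval_pw_nat_mono) (use assms less_exp[of N] in auto)
  also have "?s (2 ^ N) = sval (pw 1) n ^ 2 ^ N" using sval_pw_power2[of 1 N n] by simp
  also have "(sval (pw 1) n ^ 2 ^ N) ^ N = (sval (pw 1) n ^ N) ^ 2 ^ N"
    by (simp only: power_mult[symmetric] mult.commute)
  finally have le: "?s N ^ 2 ^ N \<le> (sval (pw 1) n ^ N) ^ 2 ^ N" .
  show "?s N \<le> sval (pw 1) n ^ N"
    by (rule power_mono_iff[THEN iffD1, OF _ _ _ le]) (use nn[of 1] nn in auto)
qed

lemma sval_pw_mult_le_2:
  assumes "0 \<le> a" "a \<le> b" "b \<le> a + 1"
  shows "sval (pw b) n \<le> 2 * sval (pw a) n"
proof (rule sval_le_if_norm_le)
  fix u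
  have "pw b u = pw (b - a) (pw a u)" using assms by (simp add: pw_pw)
  then show "norm (pw b u) \<le> 2 * norm (pw a u)" using norm_pw_le_2[of "b - a"] assms by simp
qed (use assms bop_pw in auto)

text \<open>The exponent \<open>2 ^ m * t\<close> lies between integers \<open>N\<close> and
  \<open>N + 1\<close>, and passing to either of them costs a factor \<open>2\<close> by
  \<open>sval_pw_mult_le_2\<close>. Taking logarithms and dividing by \<open>2 ^ m\<close> makes
  both the factor and the rounding error vanish as \<open>m\<close> grows.\<close>

lemma sval_pw:
  assumes t: "0 < t" shows "sval (pw t) n = sval (pw 1) n powr t"
proof -
  define a b where "a = sval (pw 1) n" and "b = sval (pw t) n"
  have nn: "0 \<le> a" "0 \<le> b" unfolding a_def b_def using t by (simp_all add: sval_nonneg bop_pw)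
  have key: "b ^ 2 ^ m \<le> 2 * a ^ N" "a ^ Suc N \<le> 2 * b ^ 2 ^ m"
    if N: "N = nat \<lfloor>2 ^ m * t\<rfloor>" "1 \<le> N" for m N
  proof -
    have le: "real N \<le> 2 ^ m * t" "2 ^ m * t \<le> real N + 1"
      using N t by (auto simp: of_nat_nat le_floor_iff) 
    have "b ^ 2 ^ m = sval (pw (2 ^ m * t)) n" using sval_pw_power2[of t m n] t by (simp add: b_def)
    moreover have "sval (pw (2 ^ m * t)) n \<le> 2 * sval (pw (real N)) n"
      by (rule sval_pw_mult_le_2) (use le in auto)
    moreover have "sval (pw (real (Suc N))) n \<le> 2 * sval (pw (2 ^ m * t)) n"
      by (rule sval_pw_mult_le_2) (use le t in auto)
    ultimately show "b ^ 2 ^ m \<le> 2 * a ^ N" "a ^ Suc N \<le> 2 * b ^ 2 ^ m"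
      using sval_pw_nat[of N n] sval_pw_nat[of "Suc N" n] N(2) by (simp_all add: a_def)
  qed
  \<comment> \<open>From \<open>m0\<close> on the integer part of \<open>2 ^ m * t\<close> is at
    least \<open>1\<close>, as \<open>sval_pw_nat\<close> requires.\<close>
  obtain m0 where m0: "1 / t < 2 ^ m0" using real_arch_pow[of 2 "1/t"] by auto
  have Npos: "1 \<le> nat \<lfloor>2 ^ m * t\<rfloor>" if "m0 \<le> m" for m
  proof -
    have "1 / t < 2 ^ m" using m0 power_increasing[OF that, of "2::real"] by linarith
    then have "1 < 2 ^ m * t" using t by (simp add: field_simps)
    then show ?thesis by (simp add: le_nat_iff le_floor_iff)
  qed
  have "b = a powr t"
  proof (cases "a = 0")
    case True
    have "b ^ 2 ^ m0 \<le> 2 * a ^ nat \<lfloor>2 ^ m0 * t\<rfloor>" by (rule key(1)) (use Npos in auto)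
    moreover have "nat \<lfloor>2 ^ m0 * t\<rfloor> \<noteq> 0" using Npos[OF order_refl] by (metis not_one_le_zero)
    ultimately have "b ^ 2 ^ m0 \<le> 0" using True by (simp only: power_0_left if_False mult_zero_right)
    then have "b = 0" using nn by (metis antisym power_eq_0_iff zero_le_power)
    then show ?thesis using True by simp
  next
    case False
    then have a: "0 < a" using nn by simp
    have b: "0 < b"
    proof (rule ccontr)
      assume "\<not> ?thesis"
      then have "b = 0" using nn by simp
      then have "a ^ Suc (nat \<lfloor>2 ^ m0 * t\<rfloor>) \<le> 0"
        using key(2)[OF refl Npos[OF order_refl]] by (simp add: power_0_left)
      then show False using zero_less_power[OF a] by (metis not_le)
    qed
    have bound: "\<bar>ln b - t * ln a\<bar> \<le> (ln 2 + \<bar>ln a\<bar>) * (1 / 2) ^ m" if "m0 \<le> m" for m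
    proof -
      define N where "N = nat \<lfloor>2 ^ m * t\<rfloor>"
      have h: "real N \<le> 2 ^ m * t" "2 ^ m * t \<le> real N + 1"
        unfolding N_def using Npos[OF that] t by (auto simp: of_nat_nat le_floor_iff)
      have k: "b ^ 2 ^ m \<le> 2 * a ^ N" "a ^ Suc N \<le> 2 * b ^ 2 ^ m"
        using key[OF N_def] Npos[OF that] unfolding N_def by auto
      have "ln (b ^ 2 ^ m) \<le> ln (2 * a ^ N)" using k(1) a b by (subst ln_le_cancel_iff) auto
      then have 1: "2 ^ m * ln b \<le> ln 2 + real N * ln a"
        using a b by (simp add: ln_mult ln_realpow)
      have "ln (a ^ Suc N) \<le> ln (2 * b ^ 2 ^ m)" using k(2) a b by (subst ln_le_cancel_iff) auto
      then have 2: "(real N + 1) * ln a \<le> ln 2 + 2 ^ m * ln b"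
        using a b by (simp only: ln_mult ln_realpow zero_less_power zero_less_numeral) (simp add: algebra_simps)
      have 3: "\<bar>(2 ^ m * t - real N) * ln a\<bar> \<le> 1 * \<bar>ln a\<bar>"
        unfolding abs_mult by (rule mult_right_mono) (use h in auto)
      have 4: "\<bar>(real N + 1 - 2 ^ m * t) * ln a\<bar> \<le> 1 * \<bar>ln a\<bar>"
        unfolding abs_mult by (rule mult_right_mono) (use h in auto)
      have "\<bar>2 ^ m * (ln b - t * ln a)\<bar> \<le> ln 2 + \<bar>ln a\<bar>"
        using 1 2 3 4 by (simp add: algebra_simps abs_le_iff)
      then have "2 ^ m * \<bar>ln b - t * ln a\<bar> \<le> ln 2 + \<bar>ln a\<bar>" by (simp add: abs_mult)
      then show ?thesis by (simp add: power_one_over field_simps)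
    qed
    have "(\<lambda>m. (ln 2 + \<bar>ln a\<bar>) * (1 / 2) ^ m) \<longlonglongrightarrow> (ln 2 + \<bar>ln a\<bar>) * 0"
      by (intro tendsto_intros LIMSEQ_power_zero) auto
    then have "\<bar>ln b - t * ln a\<bar> \<le> (ln 2 + \<bar>ln a\<bar>) * 0"
      by (rule LIMSEQ_le_const) (use bound in blast)
    then have "ln b = t * ln a" by simp
    then show ?thesis using a b by (metis exp_ln less_imp_neq powr_def)
  qed
  then show ?thesis by (simp add: a_def b_def)
qed

end

section \<open>Positive operators and the power \<open>oppow\<close>\<close>

definition posop :: "('a::complex_hilbert \<Rightarrow> 'a) \<Rightarrow> bool" where
  "posop P \<longleftrightarrow> bop P \<and> (\<forall>x y. cinner (P x) y = cinner x (P y)) \<and> (\<forall>x. 0 \<le> Re (cinner (P x) x))"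

lemma posop_cinner_self:
  assumes "posop P" shows "cinner (P x) x = of_real (Re (cinner (P x) x))"
proof -
  have "cinner (P x) x = cnj (cinner (P x) x)"
    using assms cinner_commute[of "P x" x] unfolding posop_def by metis
  then have "Im (cinner (P x) x) = 0" by (simp add: complex_eq_iff)
  then show ?thesis by (simp add: complex_eq_iff)
qed

lemma posop_Cauchy_Schwarz:
  assumes "posop P"
  shows "(cmod (cinner (P x) y))\<^sup>2 \<le> Re (cinner (P x) x) * Re (cinner (P y) y)"
proof (rule Cauchy_Schwarz_of_form)
  note P = assms[unfolded posop_def]
  fix c
  have "0 \<le> Re (cinner (P (x + scaleC c y)) (x + scaleC c y))" using P by blast
  also have "\<dots> = Re (cinner (P x) x) + Re (c * cnj c * cinner (P y) y)
      + (Re (cnj c * cinner (P x) y) + Re (c * cinner (P y) x))"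
    using P by (simp add: bop_add bop_scaleC cinner.add_left cinner.add_right cinner_scaleC_left
        cinner_scaleC_right algebra_simps)
  also have "Re (c * cinner (P y) x) = Re (cnj c * cinner (P x) y)"
  proof -
    have "cinner (P y) x = cnj (cinner (P x) y)" using P cinner_commute by metis
    then have "c * cinner (P y) x = cnj (cnj c * cinner (P x) y)" by simp
    then show ?thesis by (metis cnj.simps(1))
  qed
  also have "c * cnj c * cinner (P y) y = of_real ((cmod c)\<^sup>2 * Re (cinner (P y) y))"
    by (subst posop_cinner_self[OF assms]) (simp only: complex_norm_square of_real_mult)
  finally show "0 \<le> Re (cinner (P x) x) + (cmod c)\<^sup>2 * Re (cinner (P y) y)
      + 2 * Re (cnj c * cinner (P x) y)" by simp
qed (use assms in \<open>auto simp: posop_def\<close>)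

text \<open>As forms, \<open>0 <= R <= I\<close> because \<open>P\<close> lies between
  \<open>0\<close> and \<open>onorm P\<close>. Cauchy-Schwarz for the form of \<open>R\<close> at
  the pair \<open>x\<close>, \<open>R x\<close> turns this into
  \<open>norm (R x)^4 <= norm x^2 * norm (R x)^2\<close>.\<close>

lemma posop_contraction:
  assumes "posop P" "onorm P \<noteq> 0"
  shows "selfadjoint_contraction (\<lambda>x. x - (1 / onorm P) *\<^sub>R P x)" (is "selfadjoint_contraction ?R")
proof
  note P = assms(1)[unfolded posop_def]
  have c: "0 < onorm P" using bop_onorm_nonneg[of P] P assms(2) by simp
  show "bop ?R" using P by (intro bop_minus_op bop_ident bop_scaleR_op) auto
  show sa: "cinner (?R x) y = cinner x (?R y)" for x y
    using P by (simp add: cinner.diff_left cinner.diff_right cinner_scaleR_left cinner_scaleR_right)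
  have form: "Re (cinner (?R x) x) = (norm x)\<^sup>2 - Re (cinner (P x) x) / onorm P" for x
    by (simp add: cinner.diff_left cinner_scaleR_left Re_cinner_self)
  have le: "Re (cinner (?R x) x) \<le> (norm x)\<^sup>2" for x
  proof -
    have "0 \<le> Re (cinner (P x) x)" using P by blast
    then show ?thesis using c by (simp add: form)
  qed
  have "0 \<le> Re (cinner (?R x) x)" for x
  proof -
    have "Re (cinner (P x) x) \<le> norm (P x) * norm x"
      by (meson cinner_Cauchy_Schwarz complex_Re_le_cmod order_trans)
    also have "\<dots> \<le> onorm P * norm x * norm x" using P by (intro mult_right_mono bop_onorm) auto
    finally show ?thesis using c by (simp add: form field_simps power2_eq_square)
  qed
  then have pos: "posop ?R" using \<open>bop ?R\<close> sa unfolding posop_def by blast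
  fix x
  have "((norm (?R x))\<^sup>2)\<^sup>2 = (cmod (cinner (?R x) (?R x)))\<^sup>2"
    by (simp only: cinner_self norm_of_real power2_abs)
  also have "\<dots> \<le> Re (cinner (?R x) x) * Re (cinner (?R (?R x)) (?R x))"
    by (rule posop_Cauchy_Schwarz[OF pos])
  also have "\<dots> \<le> (norm x)\<^sup>2 * (norm (?R x))\<^sup>2"
    using pos[unfolded posop_def] by (intro mult_mono le zero_le_power2) blast
  finally have "(norm (?R x))\<^sup>2 * (norm (?R x))\<^sup>2 \<le> (norm x)\<^sup>2 * (norm (?R x))\<^sup>2"
    by (simp add: power2_eq_square)
  then have "(norm (?R x))\<^sup>2 \<le> (norm x)\<^sup>2"
    by (metis mult_right_le_imp_le zero_le_power2 order_le_less)
  then show "norm (?R x) \<le> norm x" by (rule power2_le_imp_le) simp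
qed

lemma oppow_zero: "onorm P = 0 \<Longrightarrow> oppow P \<theta> = (\<lambda>x. 0)"
  by (simp add: oppow_def)

lemma oppow_eq_pw:
  assumes "posop P" "onorm P \<noteq> 0"
  shows "oppow P \<theta> x = (onorm P powr \<theta>) *\<^sub>R
    selfadjoint_contraction.pw (\<lambda>x. x - (1 / onorm P) *\<^sub>R P x) \<theta> x"
  using assms(2) unfolding selfadjoint_contraction.pw_def[OF posop_contraction[OF assms]] bcoeff_def
  by (simp add: oppow_def Let_def)

lemma posop_onorm_0: "posop P \<Longrightarrow> onorm P = 0 \<Longrightarrow> P x = 0"
  using onorm_eq_0[OF bop_bounded_linear] unfolding posop_def by blast

lemma oppow_1: assumes "posop P" shows "oppow P 1 x = P x"
proof (cases "onorm P = 0")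
  case True then show ?thesis using posop_onorm_0[OF assms] by (simp add: oppow_zero)
next
  case False
  then interpret selfadjoint_contraction "\<lambda>x. x - (1 / onorm P) *\<^sub>R P x"
    by (rule posop_contraction[OF assms])
  have "onorm P > 0" using assms False bop_onorm_nonneg[of P] by (simp add: posop_def)
  then show ?thesis by (simp add: oppow_eq_pw[OF assms False] pw_1)
qed

lemma oppow_oppow:
  assumes "posop P" "0 < s" "0 < t" shows "oppow P s (oppow P t x) = oppow P (s + t) x"
proof (cases "onorm P = 0")
  case True then show ?thesis by (simp add: oppow_zero)
next
  case False
  then interpret selfadjoint_contraction "\<lambda>x. x - (1 / onorm P) *\<^sub>R P x"
    by (rule posop_contraction[OF assms(1)])
  show ?thesis using assms
    by (simp add: oppow_eq_pw[OF assms(1) False] bop_scaleR[OF bop_pw] pw_pw powr_add)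
qed

lemma posop_oppow:
  assumes "posop P" "0 < t" shows "posop (oppow P t)"
proof (cases "onorm P = 0")
  case True then show ?thesis by (simp add: oppow_zero posop_def bop_zero cinner.zero_left cinner.zero_right)
next
  case False
  then interpret selfadjoint_contraction "\<lambda>x. x - (1 / onorm P) *\<^sub>R P x"
    by (rule posop_contraction[OF assms(1)])
  have eq: "oppow P s = (\<lambda>x. (onorm P powr s) *\<^sub>R pw s x)" for s
    by (rule ext) (rule oppow_eq_pw[OF assms(1) False])
  have b: "bop (oppow P t)" unfolding eq by (intro bop_scaleR_op bop_pw) (use assms in simp)
  have sa: "cinner (oppow P s x) y = cinner x (oppow P s y)" if "0 < s" for s x y
    using that by (simp add: eq cinner_scaleR_left cinner_scaleR_right pw_selfadjoint)
  have "0 \<le> Re (cinner (oppow P t x) x)" for x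
  proof -
    have "cinner (oppow P t x) x = cinner (oppow P (t/2) x) (oppow P (t/2) x)"
      using oppow_oppow[OF assms(1), of "t/2" "t/2" x] assms(2) sa[of "t/2" "oppow P (t/2) x" x] by simp
    then show ?thesis by (simp add: Re_cinner_self)
  qed
  with b sa[OF assms(2)] show ?thesis unfolding posop_def by blast
qed

text \<open>After normalisation by \<open>onorm P\<close> this is \<open>sval_pw\<close>; the scalar
  in front contributes \<open>onorm P powr t\<close>. The zero operator, which has no normalisation,
  is separate.\<close>

lemma sval_oppow:
  assumes "posop P" "0 < t" shows "sval (oppow P t) n = sval P n powr t"
proof (cases "onorm P = 0")
  case True
  have z: "P = (\<lambda>x. 0)" using posop_onorm_0[OF assms(1) True] by auto
  have "sval (\<lambda>x. 0 :: 'a) n = 0"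
    by (intro antisym sval_nonneg sval_le[where F = "\<lambda>x. 0"] bop_zero rank_le_zero) auto
  then show ?thesis using oppow_zero[OF True] by (simp add: z)
next
  case False
  then interpret selfadjoint_contraction "\<lambda>x. x - (1 / onorm P) *\<^sub>R P x"
    by (rule posop_contraction[OF assms(1)])
  have c: "onorm P > 0" using assms False bop_onorm_nonneg[of P] by (simp add: posop_def)
  have *: "sval (oppow P s) n = onorm P powr s * sval (pw s) n" if "0 < s" for s
  proof -
    have "oppow P s = (\<lambda>x. (onorm P powr s) *\<^sub>R pw s x)"
      by (rule ext) (rule oppow_eq_pw[OF assms(1) False])
    then show ?thesis using sval_scaleR[OF bop_pw, of s "onorm P powr s" n] that c by simp
  qed
  have "oppow P 1 = P" by (rule ext) (rule oppow_1[OF assms(1)])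
  then have "sval P n = onorm P * sval (pw 1) n" using *[of 1] c by simp
  then show ?thesis using *[OF assms(2)] sval_pw[OF assms(2), of n] c
    by (simp add: powr_mult sval_nonneg bop_pw)
qed

lemma posop_adj_comp: assumes "bop A" shows "posop (adj A \<circ> A)"
  unfolding posop_def comp_def using assms
  by (auto simp: cinner_adj_left cinner_adj[symmetric] Re_cinner_self intro: bop_compose bop_adj)

lemma posop_opabs: "bop A \<Longrightarrow> posop (opabs A)"
  unfolding opabs_def by (intro posop_oppow posop_adj_comp) auto

lemma opabs_opabs: "bop A \<Longrightarrow> opabs A (opabs A x) = adj A (A x)"
  unfolding opabs_def by (simp add: oppow_oppow posop_adj_comp oppow_1)

lemma norm_opabs: assumes "bop A" shows "norm (opabs A x) = norm (A x)"
proof -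
  have "cinner (opabs A x) (opabs A x) = cinner (A x) (A x)"
    using posop_opabs[OF assms] opabs_opabs[OF assms, of x]
    by (metis posop_def cinner_adj_left[OF assms])
  then show ?thesis by (simp add: norm_cinner)
qed

lemma sval_oppow_opabs:
  assumes "bop X" "0 < t" shows "sval (oppow (opabs X) t) n = sval X n powr t"
proof -
  have "sval (opabs X) n = sval X n"
    using posop_opabs[OF assms(1)] by (intro sval_cong_norm norm_opabs assms) (simp_all add: posop_def)
  then show ?thesis using sval_oppow[OF posop_opabs[OF assms(1)] assms(2)] by simp
qed

subsection \<open>Gram determinants\<close>

definition Gram :: "('a::complex_hilbert \<Rightarrow> 'a) \<Rightarrow> nat \<Rightarrow> (nat \<Rightarrow> 'a) \<Rightarrow> complex mat" where
  "Gram P n e = mat n n (\<lambda>(i, j). cinner (P (e i)) (e j))"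

lemma Gram_change:
  assumes "bop P" and u: "\<And>i. i < n \<Longrightarrow> u i = (\<Sum>j<n. scaleC (W i j) (e j))"
  shows "Determinant.det (Gram P n u) = Determinant.det (mat n n (\<lambda>(i, j). W i j))
    * Determinant.det (Gram P n e) * Determinant.det (mat n n (\<lambda>(i, j). cnj (W j i)))"
proof -
  let ?W = "mat n n (\<lambda>(i, j). W i j)" and ?V = "mat n n (\<lambda>(i, j). cnj (W j i))"
  have G: "Gram P n e \<in> carrier_mat n n" by (simp add: Gram_def)
  have "Gram P n u = ?W * Gram P n e * ?V"
  proof (rule eq_matI)
    fix i j assume "i < dim_row (?W * Gram P n e * ?V)" "j < dim_col (?W * Gram P n e * ?V)"
    then have ij: "i < n" "j < n" by auto
    have "Gram P n u $$ (i, j) = (\<Sum>l<n. \<Sum>k<n. W i k * cinner (P (e k)) (e l) * cnj (W j l))"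
      using ij by (simp add: Gram_def u bop_sum[OF assms(1)] bop_scaleC[OF assms(1)]
          cinner.sum_left cinner.sum_right cinner_scaleC_left cinner_scaleC_right sum_distrib_left ac_simps)
         (rule sum.swap)
    also have "\<dots> = (?W * Gram P n e * ?V) $$ (i, j)"
      using ij by (simp add: Gram_def scalar_prod_def sum_distrib_right lessThan_atLeast0)
    finally show "Gram P n u $$ (i, j) = (?W * Gram P n e * ?V) $$ (i, j)" .
  qed (simp_all add: Gram_def)
  then show ?thesis using G
    by (simp add: Determinant.det_mult[OF mult_carrier_mat[of _ n n _ n]] Determinant.det_mult[of _ n])
qed

lemma det_Gram_orthogonal:
  assumes "\<And>i j. i < n \<Longrightarrow> j < n \<Longrightarrow> i \<noteq> j \<Longrightarrow> cinner (P (x i)) (x j) = 0"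
  shows "Determinant.det (Gram P n x) = (\<Prod>k<n. cinner (P (x k)) (x k))"
  by (subst det_lower_triangular[of n])
     (auto simp: Gram_def assms prod_list_diag_prod atLeast0LessThan)

text \<open>Pad the \<open>n\<close> equations with a zero row: every Leibniz term of the
  determinant picks an entry of that row, so the square matrix is singular.\<close>

lemma nontrivial_solution:
  fixes A :: "nat \<Rightarrow> nat \<Rightarrow> complex"
  shows "\<exists>a. (\<exists>j\<le>n. a j \<noteq> 0) \<and> (\<forall>i<n. (\<Sum>j\<le>n. A i j * a j) = 0)"
proof -
  let ?A = "mat (Suc n) (Suc n) (\<lambda>(i, j). if i < n then A i j else 0)"
  have "Determinant.det ?A = 0"
    unfolding Determinant.det_def by (auto intro!: sum.neutral prod_zero bexI[of _ n])
  moreover have cA: "?A \<in> carrier_mat (Suc n) (Suc n)" by simp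
  ultimately obtain v where v: "v \<in> carrier_vec (Suc n)" "v \<noteq> 0\<^sub>v (Suc n)" "?A *\<^sub>v v = 0\<^sub>v (Suc n)"
    using det_0_iff_vec_prod_zero[OF cA] by blast
  have "\<exists>j\<le>n. vec_index v j \<noteq> 0"
    using v(1,2) by (metis carrier_vecD eq_vecI index_zero_vec(1,2) less_Suc_eq_le)
  moreover have "(\<Sum>j\<le>n. A i j * vec_index v j) = 0" if "i < n" for i
  proof -
    have "vec_index (?A *\<^sub>v v) i = 0" using v(3) that by simp
    then show ?thesis using that v(1)
      by (simp add: scalar_prod_def atLeast0LessThan lessThan_Suc_atMost)
  qed
  ultimately show ?thesis by blast
qed


text \<open>The unit diagonal and triangularity of \<open>W\<close> are what keep Gram determinants,
  and later the diagonal of a triangular matrix, unchanged.\<close>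

definition Gram_Schmidt_coeffs ::
    "('a::complex_hilbert \<Rightarrow> 'a) \<Rightarrow> (nat \<Rightarrow> 'a) \<Rightarrow> nat \<Rightarrow> (nat \<Rightarrow> nat \<Rightarrow> complex) \<Rightarrow> (nat \<Rightarrow> 'a) \<Rightarrow> bool" where
  "Gram_Schmidt_coeffs P e n W x \<longleftrightarrow> (\<forall>k. W k k = 1) \<and> (\<forall>k j. k < j \<longrightarrow> W k j = 0) \<and>
    (\<forall>k<n. x k = (\<Sum>j\<le>k. scaleC (W k j) (e j))) \<and>
    (\<forall>i<n. \<forall>k<n. i \<noteq> k \<longrightarrow> cinner (P (x i)) (x k) = 0) \<and>
    (\<forall>k<n. Re (cinner (P (x k)) (x k)) \<le> Re (cinner (P (e k)) (e k)))"

lemma Gram_Schmidt_coeffsD: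
  assumes "Gram_Schmidt_coeffs P e n W x"
  shows "W k k = 1" "k < j \<Longrightarrow> W k j = 0" "k < n \<Longrightarrow> x k = (\<Sum>j\<le>k. scaleC (W k j) (e j))"
    "i < n \<Longrightarrow> k < n \<Longrightarrow> i \<noteq> k \<Longrightarrow> cinner (P (x i)) (x k) = 0"
    "k < n \<Longrightarrow> Re (cinner (P (x k)) (x k)) \<le> Re (cinner (P (e k)) (e k))"
    "k < n \<Longrightarrow> x k = (\<Sum>j<n. scaleC (W k j) (e j))"
proof -
  note W = assms[unfolded Gram_Schmidt_coeffs_def]
  show "W k k = 1" "k < j \<Longrightarrow> W k j = 0" "k < n \<Longrightarrow> x k = (\<Sum>j\<le>k. scaleC (W k j) (e j))"
    "i < n \<Longrightarrow> k < n \<Longrightarrow> i \<noteq> k \<Longrightarrow> cinner (P (x i)) (x k) = 0"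
    "k < n \<Longrightarrow> Re (cinner (P (x k)) (x k)) \<le> Re (cinner (P (e k)) (e k))"
    using W by blast+
  assume k: "k < n"
  then have "x k = (\<Sum>j\<le>k. scaleC (W k j) (e j))" using W by simp
  also have "\<dots> = (\<Sum>j<n. scaleC (W k j) (e j))"
    by (rule sum.mono_neutral_left) (use k W in \<open>auto simp: scaleC.zero_left not_le\<close>)
  finally show "x k = (\<Sum>j<n. scaleC (W k j) (e j))" .
qed

text \<open>If \<open>\<langle>P x\<^sub>j, x\<^sub>j\<rangle> = 0\<close> then \<open>\<langle>P e\<^sub>n, x\<^sub>j\<rangle> = 0\<close> as well, so the junk value \<open>0/0 = 0\<close> of the
Gram-Schmidt coefficient is the right one and \<open>P\<close> need not be definite.\<close>

lemma Gram_Schmidt_form: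
  assumes P: "posop P"
  shows "\<exists>W x. Gram_Schmidt_coeffs P e n W x"
proof (induction n)
  case 0
  show ?case
    by (rule exI[of _ "\<lambda>k j. if k = j then 1 else 0"]) (simp add: Gram_Schmidt_coeffs_def)
next
  case (Suc n)
  note bP = P[unfolded posop_def, THEN conjunct1]
  obtain W x where Wx: "Gram_Schmidt_coeffs P e n W x" using Suc by blast
  note W = Gram_Schmidt_coeffsD[OF Wx]
  define a where "a = (\<lambda>i. cinner (P (e n)) (x i) / cinner (P (x i)) (x i))"
  \<comment> \<open>Row \<open>n\<close> expresses \<open>e n - y\<close> in the original vectors,
    \<open>y\<close> being the \<open>P\<close>-orthogonal projection of \<open>e n\<close> onto the
    span of the earlier ones.\<close>
  define V where "V = (\<lambda>k j. if k = n then (if j < n then - (\<Sum>i<n. a i * W i j) else if j = n then 1 else 0) else W k j)"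
  define y where "y = (\<Sum>i<n. scaleC (a i) (x i))"
  have xV: "x k = (\<Sum>j\<le>k. scaleC (V k j) (e j))" if "k < n" for k
    using that by (simp add: V_def W(3))
  have xn: "e n - y = (\<Sum>j\<le>n. scaleC (V n j) (e j))"
  proof -
    have "y = (\<Sum>i<n. \<Sum>j<n. scaleC (a i * W i j) (e j))"
      unfolding y_def by (simp add: W(6) scaleC.sum_right scaleC_scaleC)
    also have "\<dots> = (\<Sum>j<n. scaleC (\<Sum>i<n. a i * W i j) (e j))"
      by (subst sum.swap) (simp add: scaleC.sum_left)
    finally show ?thesis
      by (simp add: lessThan_Suc_atMost[symmetric] V_def scaleC_one scaleC.minus_left sum_negf)
  qed
  have perp: "cinner (P (e n - y)) (x k) = 0" if k: "k < n" for k
  proof -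
    have "cinner (P y) (x k) = (\<Sum>i<n. a i * cinner (P (x i)) (x k))"
      unfolding y_def by (simp add: bop_sum[OF bP] bop_scaleC[OF bP] cinner.sum_left cinner_scaleC_left)
    also have "\<dots> = (\<Sum>i\<in>{k}. a i * cinner (P (x i)) (x k))"
      by (rule sum.mono_neutral_right) (use k W(4) in auto)
    also have "\<dots> = cinner (P (e n)) (x k)"
    proof (cases "cinner (P (x k)) (x k) = 0")
      case True
      then have "(cmod (cinner (P (e n)) (x k)))\<^sup>2 \<le> Re (cinner (P (e n)) (e n)) * 0"
        using posop_Cauchy_Schwarz[OF P, of "e n" "x k"] by simp
      then show ?thesis using True by simp
    next
      case False then show ?thesis by (simp add: a_def)
    qed
    finally show ?thesis by (simp add: bop_diff[OF bP] cinner.diff_left)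
  qed
  have perp': "cinner (P (x k)) (e n - y) = 0" if "k < n" for k
    using perp[OF that] P unfolding posop_def by (metis cinner_commute complex_cnj_zero)
  have perp_y: "cinner (P (e n - y)) y = 0"
    by (subst (2) y_def) (simp add: cinner.sum_right cinner_scaleC_right perp)
  then have perp_y': "cinner (P y) (e n - y) = 0"
    using P unfolding posop_def by (metis cinner_commute complex_cnj_zero)
  have "cinner (P (e n)) (e n) = cinner (P (e n - y)) (e n - y) + cinner (P y) y"
    using perp_y perp_y' by (simp add: bop_diff[OF bP] cinner.diff_left cinner.diff_right)
  moreover have "0 \<le> Re (cinner (P y) y)" using P unfolding posop_def by blast
  ultimately have le: "Re (cinner (P (e n - y)) (e n - y)) \<le> Re (cinner (P (e n)) (e n))" by simp
  have "Gram_Schmidt_coeffs P e (Suc n) V (x(n := e n - y))"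
    unfolding Gram_Schmidt_coeffs_def
    using W(1,2,4,5) xn xV perp perp' le by (auto simp: less_Suc_eq V_def)
  then show ?case by blast
qed

text \<open>A unitriangular change of vectors preserves the determinant, and for
  \<open>P\<close>-orthogonal vectors the Gram matrix is diagonal. The factors are the squared
  \<open>P\<close>-distances from \<open>e k\<close> to the span of its predecessors.\<close>

lemma Gram_heights:
  assumes P: "posop P"
  obtains x where "\<And>k. k < n \<Longrightarrow> \<exists>a. x k = e k + (\<Sum>j<k. scaleC (a j) (e j))"
    and "Determinant.det (Gram P n e) = of_real (\<Prod>k<n. Re (cinner (P (x k)) (x k)))"
    and "\<And>k. k < n \<Longrightarrow> Re (cinner (P (x k)) (x k)) \<le> Re (cinner (P (e k)) (e k))"
proof -
  note bP = P[unfolded posop_def, THEN conjunct1]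
  obtain W x where Wx: "Gram_Schmidt_coeffs P e n W x" using Gram_Schmidt_form[OF P] by blast
  note W = Gram_Schmidt_coeffsD[OF Wx]
  have dW: "Determinant.det (mat n n (\<lambda>(i, j). W i j)) = 1"
    by (subst det_lower_triangular[of n]) (auto simp: prod_list_diag_prod W)
  have dV: "Determinant.det (mat n n (\<lambda>(i, j). cnj (W j i))) = 1"
    by (subst det_upper_triangular[of _ n]) (auto simp: prod_list_diag_prod W)
  have "Determinant.det (Gram P n x) = Determinant.det (Gram P n e)"
    using Gram_change[OF bP W(6)] dW dV by simp
  moreover have "Determinant.det (Gram P n x) = (\<Prod>k<n. cinner (P (x k)) (x k))"
    by (rule det_Gram_orthogonal) (rule W(4))
  moreover have "\<dots> = (\<Prod>k<n. of_real (Re (cinner (P (x k)) (x k))))"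
    by (rule prod.cong[OF refl posop_cinner_self[OF P]])
  ultimately have det: "Determinant.det (Gram P n e) = of_real (\<Prod>k<n. Re (cinner (P (x k)) (x k)))"
    by simp
  have "\<exists>a. x k = e k + (\<Sum>j<k. scaleC (a j) (e j))" if "k < n" for k
    by (rule exI[of _ "W k"])
       (simp add: W(3)[OF that] lessThan_Suc_atMost[symmetric] W(1) scaleC_one add.commute)
  then show thesis by (rule that[OF _ det W(5)])
qed

section \<open>Orthonormal families and the product inequality\<close>

definition orthonormal :: "(nat \<Rightarrow> 'a::complex_hilbert) \<Rightarrow> nat \<Rightarrow> bool" where
  "orthonormal e n \<longleftrightarrow> (\<forall>i<n. \<forall>j<n. cinner (e i) (e j) = (if i = j then 1 else 0))"

lemma orthonormal_ons: "orthonormal e n \<Longrightarrow> ons e n"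
  unfolding orthonormal_def ons_def by (auto simp: norm_cinner)

text \<open>Applied to the identity, whose Gram determinant is \<open>1\<close> on orthonormal
  families, \<open>Gram_change\<close> shows that the determinants of the coefficient matrix and of
  its conjugate transpose multiply to \<open>1\<close>.\<close>

lemma det_Gram_orthonormal_change:
  assumes "bop P" "orthonormal e n" "orthonormal u n"
    and "\<And>i. i < n \<Longrightarrow> \<exists>a. u i = (\<Sum>j<n. scaleC (a j) (e j))"
  shows "Determinant.det (Gram P n u) = Determinant.det (Gram P n e)"
proof -
  obtain W where W: "\<And>i. i < n \<Longrightarrow> u i = (\<Sum>j<n. scaleC (W i j) (e j))"
    using assms(4) by metis
  let ?W = "Determinant.det (mat n n (\<lambda>(i, j). W i j))" and ?V = "Determinant.det (mat n n (\<lambda>(i, j). cnj (W j i)))"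
  have one: "Determinant.det (Gram (\<lambda>x. x) n v) = 1" if "orthonormal v n" for v
    by (subst det_Gram_orthogonal) (use that in \<open>auto simp: orthonormal_def\<close>)
  have "1 = ?W * 1 * ?V"
    using Gram_change[where u = u and W = W and e = e, OF bop_ident W]
    unfolding one[OF assms(2)] one[OF assms(3)] .
  then show ?thesis using Gram_change[where u = u and W = W and e = e, OF assms(1) W] by (simp add: mult.commute mult.left_commute)
qed

text \<open>An orthonormal basis \<open>u\<close> of the same span is built on which
  \<open>P\<close> is small: \<open>norm (P (u i)) <= c (n - Suc i)\<close>. The Gram determinant is
  unchanged, and each height is at most \<open>norm (P (u i))\<close>.\<close>

lemma det_Gram_le:
  assumes P: "posop P" and e: "orthonormal e n" and c: "\<And>k. k < n \<Longrightarrow> sval P k < c k"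
  shows "Re (Determinant.det (Gram P n e)) \<le> (\<Prod>k<n. c k)"
proof -
  note bP = P[unfolded posop_def, THEN conjunct1]
  have cpos: "0 \<le> c k" if "k < n" for k using sval_nonneg[OF bP, of k] c[OF that] by linarith
  have "\<exists>u. orthonormal u m \<and> (\<forall>i<m. \<exists>a. u i = (\<Sum>j<n. scaleC (a j) (e j))) \<and>
      (\<forall>i<m. norm (P (u i)) \<le> c (n - Suc i))" if "m \<le> n" for m
    using that
  proof (induction m)
    case 0 show ?case by (simp add: orthonormal_def)
  next
    case (Suc m)
    then obtain u where u: "orthonormal u m" "\<forall>i<m. \<exists>a. u i = (\<Sum>j<n. scaleC (a j) (e j))"
      "\<forall>i<m. norm (P (u i)) \<le> c (n - Suc i)" by auto
    \<comment> \<open>The new vector must satisfy the \<open>k\<close> kernel constraints from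
      \<open>sval_ker\<close> and be orthogonal to \<open>m\<close> earlier vectors:
      \<open>k + m = n - 1\<close> linear conditions on \<open>n\<close> coefficients.\<close>
    define k where "k = n - Suc m"
    have k: "k < n" using Suc by (simp add: k_def)
    have n: "n = Suc (k + m)" using Suc by (simp add: k_def)
    obtain w where w: "\<forall>v. (\<forall>i<k. cinner v (w i) = 0) \<longrightarrow> norm (P v) \<le> c k * norm v"
      using sval_ker[OF bP c[OF k]] by blast
    obtain a where a: "\<exists>j\<le>k + m. a j \<noteq> 0"
      "\<forall>i<k + m. (\<Sum>j\<le>k + m. cinner (e j) (if i < k then w i else u (i - k)) * a j) = 0"
      using nontrivial_solution[of "k + m" "\<lambda>i j. cinner (e j) (if i < k then w i else u (i - k))"] by auto
    define v where "v = (\<Sum>j<n. scaleC (a j) (e j))"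
    have vperp: "cinner v (if i < k then w i else u (i - k)) = 0" if "i < k + m" for i
      using a(2) that unfolding v_def n
      by (simp add: cinner.sum_left cinner_scaleC_left lessThan_Suc_atMost mult.commute)
    have vw: "cinner v (w i) = 0" if "i < k" for i using vperp[of i] that by simp
    have vu: "cinner v (u i) = 0" if "i < m" for i using vperp[of "k + i"] that by simp
    obtain j where j: "j < n" "a j \<noteq> 0" using a(1) n by (auto simp: less_Suc_eq_le)
    have "cinner v (e j) = (\<Sum>i<n. a i * cinner (e i) (e j))"
      by (simp add: v_def cinner.sum_left cinner_scaleC_left)
    also have "\<dots> = (\<Sum>i\<in>{j}. a i * cinner (e i) (e j))"
      by (rule sum.mono_neutral_right) (use j e in \<open>auto simp: orthonormal_def\<close>)
    also have "\<dots> \<noteq> 0" using j e by (simp add: orthonormal_def)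
    finally have v0: "v \<noteq> 0" by (auto simp: cinner.zero_left)
    define z where "z = inverse (norm v) *\<^sub>R v"
    have nz: "norm z = 1" using v0 by (simp add: z_def)
    have zu: "cinner z (u i) = 0" "cinner (u i) z = 0" if "i < m" for i
    proof -
      show "cinner z (u i) = 0" using vu[OF that] by (simp add: z_def cinner_scaleR_left)
      then show "cinner (u i) z = 0" by (metis cinner_commute complex_cnj_zero)
    qed
    have zP: "norm (P z) \<le> c k"
      using w[rule_format, of z] nz vw by (simp add: z_def cinner_scaleR_left)
    have z_span: "z = (\<Sum>j<n. scaleC (of_real (inverse (norm v)) * a j) (e j))"
      by (simp add: z_def v_def scaleR_scaleC scaleC.sum_right scaleC_scaleC del: of_real_inverse)
    show ?case
    proof (intro exI[of _ "u(m := z)"] conjI allI impI)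
      show "orthonormal (u(m := z)) (Suc m)"
        using u(1) zu nz unfolding orthonormal_def by (auto simp: less_Suc_eq cinner_self)
      show "\<exists>a. (u(m := z)) i = (\<Sum>j<n. scaleC (a j) (e j))" if "i < Suc m" for i
        using u(2) that z_span by (cases "i = m") auto
      show "norm (P ((u(m := z)) i)) \<le> c (n - Suc i)" if "i < Suc m" for i
        using u(3) that zP by (cases "i = m") (auto simp: k_def)
    qed
  qed
  then obtain u where u: "orthonormal u n" "\<And>i. i < n \<Longrightarrow> \<exists>a. u i = (\<Sum>j<n. scaleC (a j) (e j))"
    "\<And>i. i < n \<Longrightarrow> norm (P (u i)) \<le> c (n - Suc i)" by blast
  obtain x where x: "Determinant.det (Gram P n u) = of_real (\<Prod>k<n. Re (cinner (P (x k)) (x k)))"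
    "\<And>k. k < n \<Longrightarrow> Re (cinner (P (x k)) (x k)) \<le> Re (cinner (P (u k)) (u k))"
    using Gram_heights[OF P, of n u] by metis
  have "Re (Determinant.det (Gram P n e)) = (\<Prod>k<n. Re (cinner (P (x k)) (x k)))"
    using det_Gram_orthonormal_change[OF bP e u(1,2)] x(1) by (metis Re_complex_of_real)
  also have "\<dots> \<le> (\<Prod>k<n. c (n - Suc k))"
  proof (rule prod_mono, rule conjI)
    fix k assume "k \<in> {..<n}"
    then have k: "k < n" by simp
    show "0 \<le> Re (cinner (P (x k)) (x k))" using P unfolding posop_def by blast
    have "Re (cinner (P (u k)) (u k)) \<le> norm (P (u k)) * norm (u k)"
      by (meson cinner_Cauchy_Schwarz complex_Re_le_cmod order_trans)
    also have "norm (u k) = 1" using u(1) k by (simp add: orthonormal_def norm_cinner)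
    finally show "Re (cinner (P (x k)) (x k)) \<le> c (n - Suc k)" using x(2)[OF k] u(3)[OF k] by simp
  qed
  also have "\<dots> = (\<Prod>k<n. c k)" by (rule prod.nat_diff_reindex)
  finally show ?thesis .
qed

text \<open>Bases in which \<open>X\<close> is triangular with large diagonal; they replace a singular value
decomposition.\<close>

lemma triangular_bases:
  assumes X: "bop X" and d: "\<And>k. k < n \<Longrightarrow> 0 \<le> d k \<and> d k < sval X k"
  shows "\<exists>e f. orthonormal e n \<and> orthonormal f n \<and> (\<forall>j<n. proj f n (X (e j)) = X (e j)) \<and>
    (\<forall>k<n. \<forall>j<k. cinner (X (e j)) (f k) = 0) \<and> (\<forall>k<n. d k \<le> cmod (cinner (X (e k)) (f k)))"
  using d
proof (induction n)
  case 0 show ?case by (simp add: orthonormal_def)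
next
  case (Suc n)
  then obtain e f where ef: "orthonormal e n" "orthonormal f n" "\<And>j. j < n \<Longrightarrow> proj f n (X (e j)) = X (e j)"
    "\<And>j k. k < n \<Longrightarrow> j < k \<Longrightarrow> cinner (X (e j)) (f k) = 0" "\<And>k. k < n \<Longrightarrow> d k \<le> cmod (cinner (X (e k)) (f k))"
    by (metis less_SucI)
  \<comment> \<open>\<open>D\<close> is the part of \<open>X\<close> outside the span of
    \<open>f\<close>. It vanishes on the span of \<open>e\<close>, and since \<open>proj f n\<close>
    after \<open>X\<close> has rank at most \<open>n\<close>, the inequality
    \<open>d n < sval X n\<close> prevents \<open>D\<close> from being bounded by
    \<open>d n\<close>.\<close>
  define D where "D = (\<lambda>x. X x - proj f n (X x))"
  have bD: "bop D" unfolding D_def by (rule bop_minus_op[OF X bop_compose[OF bop_proj X]])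
  have De: "D (proj e n x) = 0" for x
    by (simp add: proj_def bop_sum[OF bD] bop_scaleC[OF bD]) (simp add: D_def ef(3) scaleC.zero_right)
  have "\<not> (\<forall>x. norm (D x) \<le> d n * norm x)"
    using sval_le_range[OF X, of "d n" f n] Suc.prems[of n] unfolding D_def by fastforce
  then obtain x where x: "d n * norm x < norm (D x)" by (auto simp: not_le)
  \<comment> \<open>Dropping the components along \<open>e\<close> keeps \<open>D x\<close> and does
    not increase the norm, so the normalised \<open>y\<close> and \<open>D y\<close> extend the two
    families; the ratio of their norms, \<open>\<tau>\<close>, is the new diagonal entry.\<close>
  define y where "y = x - proj e n x"
  have Dy: "D y = D x" by (simp add: y_def bop_diff[OF bD] De)
  have "d n * norm y \<le> d n * norm x"
    unfolding y_def by (intro mult_left_mono norm_minus_proj_le orthonormal_ons ef) (use Suc.prems[of n] in auto)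
  then have y: "d n * norm y < norm (D y)" using x Dy by simp
  then have Dy0: "D y \<noteq> 0" using Suc.prems[of n] by (metis mult_nonneg_nonneg norm_ge_zero norm_zero not_le lessI)
  then have y0: "y \<noteq> 0" using bop_0[OF bD] by auto
  define en where "en = inverse (norm y) *\<^sub>R y"
  define fn where "fn = inverse (norm (D y)) *\<^sub>R D y"
  have nen: "norm en = 1" "norm fn = 1" using y0 Dy0 by (simp_all add: en_def fn_def)
  have e_perp: "cinner en (e i) = 0" "cinner (e i) en = 0" if "i < n" for i
  proof -
    show "cinner en (e i) = 0"
      by (simp add: en_def y_def cinner_scaleR_left cinner.diff_left cinner_proj orthonormal_ons ef that)
    then show "cinner (e i) en = 0" by (metis cinner_commute complex_cnj_zero)
  qed
  have f_perp: "cinner fn (f i) = 0" "cinner (f i) fn = 0" if "i < n" for i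
  proof -
    show "cinner fn (f i) = 0"
      by (simp add: fn_def D_def cinner_scaleR_left cinner.diff_left cinner_proj orthonormal_ons ef that)
    then show "cinner (f i) fn = 0" by (metis cinner_commute complex_cnj_zero)
  qed
  have pf: "cinner (proj f n z) fn = 0" for z
    unfolding proj_def by (simp add: cinner.sum_left cinner_scaleC_left f_perp)
  define \<tau> where "\<tau> = norm (D y) / norm y"
  have Den: "D en = \<tau> *\<^sub>R fn"
    using Dy0 y0 by (simp add: en_def fn_def \<tau>_def bop_scaleR[OF bD] field_simps)
  then have Xen: "X en = proj f n (X en) + \<tau> *\<^sub>R fn" by (simp add: D_def algebra_simps)
  have Xf: "cinner (X en) fn = of_real \<tau>"
    by (subst Xen) (simp add: cinner.add_left pf cinner_scaleR_left cinner_self nen)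
  have \<tau>: "d n \<le> \<tau>" using y y0 by (simp add: \<tau>_def field_simps)
  let ?e = "e(n := en)" and ?f = "f(n := fn)"
  have proj': "proj ?f (Suc n) z = proj f n z + scaleC (cinner z fn) fn" for z
    by (simp add: proj_def)
  have Xj: "cinner (X (e j)) fn = 0" if "j < n" for j using pf[of "X (e j)"] ef(3)[OF that] by simp
  show ?case
  proof (rule exI[of _ ?e], rule exI[of _ ?f], intro conjI allI impI)
    show "orthonormal ?e (Suc n)" "orthonormal ?f (Suc n)"
      using ef(1,2) e_perp f_perp nen unfolding orthonormal_def by (auto simp: less_Suc_eq cinner_self)
    show "proj ?f (Suc n) (X (?e j)) = X (?e j)" if "j < Suc n" for j
    proof (cases "j = n")
      case True
      have "proj ?f (Suc n) (X en) = proj f n (X en) + \<tau> *\<^sub>R fn"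
        by (simp add: proj' Xf scaleC_of_real)
      then show ?thesis using True Xen by simp
    next
      case False then show ?thesis using that ef(3)[of j] by (simp add: proj' Xj scaleC.zero_left)
    qed
    show "cinner (X (?e j)) (?f k) = 0" if "k < Suc n" "j < k" for j k
      using that ef(4)[of k j] Xj by (auto simp: less_Suc_eq)
    show "d k \<le> cmod (cinner (X (?e k)) (?f k))" if "k < Suc n" for k
      using that ef(5)[of k] Xf \<tau> by (auto simp: less_Suc_eq)
  qed
qed

text \<open>Strict slack in \<open>d\<close>, \<open>p\<close> and \<open>q\<close> is what
  \<open>triangular_bases\<close> and \<open>det_Gram_le\<close> consume. By \<open>dom\<close> each
  squared diagonal entry is at most a \<open>P\<close>-height times a \<open>Q\<close>-height, and
  the products of heights are Gram determinants.\<close>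

lemma prod_sval_le_aux:
  assumes X: "bop X" and P: "posop P" and Q: "posop Q"
    and dom: "\<And>x y. (cmod (cinner (X x) y))\<^sup>2 \<le> Re (cinner (P x) x) * Re (cinner (Q y) y)"
    and d: "\<And>k. k < n \<Longrightarrow> 0 \<le> d k \<and> d k < sval X k"
    and p: "\<And>k. k < n \<Longrightarrow> sval P k < p k" and q: "\<And>k. k < n \<Longrightarrow> sval Q k < q k"
  shows "(\<Prod>k<n. (d k)\<^sup>2) \<le> (\<Prod>k<n. p k) * (\<Prod>k<n. q k)"
proof -
  obtain e f where ef: "orthonormal e n" "orthonormal f n"
    "\<And>j k. k < n \<Longrightarrow> j < k \<Longrightarrow> cinner (X (e j)) (f k) = 0" "\<And>k. k < n \<Longrightarrow> d k \<le> cmod (cinner (X (e k)) (f k))"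
    using triangular_bases[where d = d and n = n, OF X d] by blast
  \<comment> \<open>Reversing \<open>f\<close> makes \<open>y (n - Suc k)\<close> equal to
    \<open>f k\<close> plus a combination of \<open>f l\<close> with \<open>l > k\<close>, whereas
    \<open>x k\<close> is \<open>e k\<close> plus a combination of \<open>e j\<close> with
    \<open>j < k\<close>.\<close>
  define g where "g = (\<lambda>k. f (n - Suc k))"
  have g: "orthonormal g n" using ef(2) unfolding orthonormal_def g_def by auto
  obtain x where x: "\<And>k. k < n \<Longrightarrow> \<exists>a. x k = e k + (\<Sum>j<k. scaleC (a j) (e j))"
    "Determinant.det (Gram P n e) = of_real (\<Prod>k<n. Re (cinner (P (x k)) (x k)))"
    using Gram_heights[OF P, of n e] by metis
  obtain y where y: "\<And>k. k < n \<Longrightarrow> \<exists>a. y k = g k + (\<Sum>j<k. scaleC (a j) (g j))"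
    "Determinant.det (Gram Q n g) = of_real (\<Prod>k<n. Re (cinner (Q (y k)) (y k)))"
    using Gram_heights[OF Q, of n g] by metis
  have XX: "cinner (X (x k)) (y (n - Suc k)) = cinner (X (e k)) (f k)" if k: "k < n" for k
  proof -
    obtain a where a: "x k = e k + (\<Sum>j<k. scaleC (a j) (e j))" using x(1)[OF k] by blast
    obtain b where b: "y (n - Suc k) = g (n - Suc k) + (\<Sum>j<n - Suc k. scaleC (b j) (g j))"
      using y(1)[of "n - Suc k"] k by auto
    have gk: "g (n - Suc k) = f k" using k by (simp add: g_def Suc_diff_Suc)
    \<comment> \<open>By triangularity \<open>X (e j)\<close> with \<open>j < k\<close> is
      orthogonal to \<open>f l\<close> for \<open>l >= k\<close>, and \<open>X (e k)\<close> pairs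
      only with \<open>f k\<close>; all corrections drop out.\<close>
    have low: "cinner (X (x k)) (f l) = (if l = k then cinner (X (e k)) (f k) else 0)" if "k \<le> l" "l < n" for l
      using that ef(3)
      by (auto simp: a bop_add[OF X] bop_sum[OF X] bop_scaleC[OF X] cinner.add_left cinner.sum_left cinner_scaleC_left
          intro!: sum.neutral)
    have "cinner (X (x k)) (g j) = 0" if "j < n - Suc k" for j
      using low[of "n - Suc j"] that by (auto simp: g_def)
    then show ?thesis
      using low[of k] k by (simp add: b gk cinner.add_right cinner.sum_right cinner_scaleC_right)
  qed
  have nn: "0 \<le> Re (cinner (P v) v)" "0 \<le> Re (cinner (Q v) v)" for v using P Q by (auto simp: posop_def)
  have "(\<Prod>k<n. (d k)\<^sup>2) \<le> (\<Prod>k<n. Re (cinner (P (x k)) (x k)) * Re (cinner (Q (y (n - Suc k))) (y (n - Suc k))))"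
  proof (rule prod_mono, rule conjI)
    fix k assume "k \<in> {..<n}"
    then have k: "k < n" by simp
    have "(d k)\<^sup>2 \<le> (cmod (cinner (X (x k)) (y (n - Suc k))))\<^sup>2"
      using ef(4)[OF k] d[OF k] XX[OF k] by (intro power_mono) auto
    also have "\<dots> \<le> Re (cinner (P (x k)) (x k)) * Re (cinner (Q (y (n - Suc k))) (y (n - Suc k)))"
      by (rule dom)
    finally show "(d k)\<^sup>2 \<le> Re (cinner (P (x k)) (x k)) * Re (cinner (Q (y (n - Suc k))) (y (n - Suc k)))" .
  qed simp
  also have "\<dots> = (\<Prod>k<n. Re (cinner (P (x k)) (x k))) * (\<Prod>k<n. Re (cinner (Q (y k)) (y k)))"
    unfolding prod.distrib prod.nat_diff_reindex[of "\<lambda>k. Re (cinner (Q (y k)) (y k))" n] ..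
  also have "\<dots> = Re (Determinant.det (Gram P n e)) * Re (Determinant.det (Gram Q n g))"
    by (simp only: x(2) y(2) Re_complex_of_real)
  also have "\<dots> \<le> (\<Prod>k<n. p k) * (\<Prod>k<n. q k)"
  proof (rule mult_mono)
    show "Re (Determinant.det (Gram P n e)) \<le> (\<Prod>k<n. p k)" by (rule det_Gram_le[OF P ef(1) p])
    moreover have "0 \<le> Re (Determinant.det (Gram P n e))"
      unfolding x(2) Re_complex_of_real by (rule prod_nonneg) (use nn in blast)
    ultimately show "0 \<le> (\<Prod>k<n. p k)" by linarith
    show "Re (Determinant.det (Gram Q n g)) \<le> (\<Prod>k<n. q k)" by (rule det_Gram_le[OF Q g q])
    show "0 \<le> Re (Determinant.det (Gram Q n g))"
      unfolding y(2) Re_complex_of_real by (rule prod_nonneg) (use nn in blast)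
  qed
  finally show ?thesis .
qed

text \<open>Limit of \<open>prod_sval_le_aux\<close> with \<open>sval X\<close> shrunk by the factor
  \<open>1 - \<epsilon> m\<close> and \<open>sval P\<close>, \<open>sval Q\<close> raised by
  \<open>\<epsilon> m\<close>. A vanishing \<open>sval X k\<close> leaves no room below it, but then
  the left side is \<open>0\<close>.\<close>

lemma prod_sval_le:
  assumes X: "bop X" and P: "posop P" and Q: "posop Q"
    and dom: "\<And>x y. (cmod (cinner (X x) y))\<^sup>2 \<le> Re (cinner (P x) x) * Re (cinner (Q y) y)"
  shows "(\<Prod>k<n. (sval X k)\<^sup>2) \<le> (\<Prod>k<n. sval P k) * (\<Prod>k<n. sval Q k)"
proof -
  have nnP: "0 \<le> sval P k" "0 \<le> sval Q k" for k using P Q by (simp_all add: sval_nonneg posop_def)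
  show ?thesis
  proof (cases "\<exists>k<n. sval X k = 0")
    case True
    then have "(\<Prod>k<n. (sval X k)\<^sup>2) = 0" by (auto intro!: prod_zero)
    moreover have "0 \<le> (\<Prod>k<n. sval P k) * (\<Prod>k<n. sval Q k)"
      using nnP by (intro mult_nonneg_nonneg prod_nonneg) auto
    ultimately show ?thesis by linarith
  next
    case False
    then have pos: "0 < sval X k" if "k < n" for k
      using sval_nonneg[OF X, of k] that by (metis order_le_less)
    define \<epsilon> where "\<epsilon> = (\<lambda>m. 1 / real (Suc m))"
    have \<epsilon>: "\<epsilon> \<longlonglongrightarrow> 0" unfolding \<epsilon>_def by (rule LIMSEQ_Suc[OF lim_1_over_n])
    have "(\<Prod>k<n. ((1 - \<epsilon> m) * sval X k)\<^sup>2) \<le> (\<Prod>k<n. sval P k + \<epsilon> m) * (\<Prod>k<n. sval Q k + \<epsilon> m)" for m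
    proof (rule prod_sval_le_aux[OF X P Q dom])
      show "0 \<le> (1 - \<epsilon> m) * sval X k \<and> (1 - \<epsilon> m) * sval X k < sval X k" if "k < n" for k
        using pos[OF that] by (simp add: \<epsilon>_def field_simps)
    qed (simp_all add: \<epsilon>_def)
    moreover have "(\<lambda>m. \<Prod>k<n. ((1 - \<epsilon> m) * sval X k)\<^sup>2) \<longlonglongrightarrow> (\<Prod>k<n. ((1 - 0) * sval X k)\<^sup>2)"
      by (intro tendsto_intros \<epsilon>)
    moreover have "(\<lambda>m. (\<Prod>k<n. sval P k + \<epsilon> m) * (\<Prod>k<n. sval Q k + \<epsilon> m))
        \<longlonglongrightarrow> (\<Prod>k<n. sval P k + 0) * (\<Prod>k<n. sval Q k + 0)"
      by (intro tendsto_intros \<epsilon>)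
    ultimately have "(\<Prod>k<n. ((1 - 0) * sval X k)\<^sup>2) \<le> (\<Prod>k<n. sval P k + 0) * (\<Prod>k<n. sval Q k + 0)"
      by (intro LIMSEQ_le) auto
    then show ?thesis by simp
  qed
qed

subsection \<open>Majorisation and symmetric gauge functions\<close>

text \<open>With \<open>d k = ln (b k) - ln (a k)\<close>, whose partial sums are nonnegative, Abel
  summation against the decreasing weights \<open>a k\<close> gives a nonnegative sum of
  \<open>a k * d k\<close>, and \<open>ln x <= x - 1\<close> gives
  \<open>a k * d k <= b k - a k\<close>. A zero entry \<open>a m\<close>, where logarithms fail,
  adds nothing on the left.\<close>

lemma sum_le_of_prod_le:
  fixes a b :: "nat \<Rightarrow> real"
  assumes "antimono a" "\<And>k. 0 \<le> a k" "\<And>k. 0 \<le> b k"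
    and prod_le: "\<And>m. (\<Prod>k<m. a k) \<le> (\<Prod>k<m. b k)"
  shows "(\<Sum>k<m. a k) \<le> (\<Sum>k<m. b k)"
proof (induction m)
  case (Suc m)
  show ?case
  proof (cases "a m = 0")
    case True
    then show ?thesis using Suc assms(3)[of m] by simp
  next
    case False
    have pos: "0 < a k" if "k < Suc m" for k
      using antimonoD[OF assms(1), of k m] assms(2)[of m] that False by simp
    have bpos: "0 < b k" if "k < Suc m" for k
    proof -
      have "0 < (\<Prod>k<Suc m. a k)" by (rule prod_pos) (use pos in auto)
      then have "(\<Prod>k<Suc m. b k) \<noteq> 0" using prod_le[of "Suc m"] by linarith
      then have "b k \<noteq> 0" using that by (metis finite_lessThan lessThan_iff prod_zero_iff)
      then show ?thesis using assms(3)[of k] by simp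
    qed
    define d where "d = (\<lambda>k. ln (b k) - ln (a k))"
    have D: "0 \<le> (\<Sum>k<l. d k)" if "l \<le> Suc m" for l
    proof -
      have "ln (\<Prod>k<l. a k) \<le> ln (\<Prod>k<l. b k)"
        by (rule ln_mono) (use prod_le[of l] that pos in \<open>auto intro!: prod_pos\<close>)
      moreover have "a i \<noteq> 0" "b i \<noteq> 0" if "i \<in> {..<l}" for i
        using pos[of i] bpos[of i] that \<open>l \<le> Suc m\<close> by auto
      then have "ln (\<Prod>k<l. a k) = (\<Sum>k<l. ln (a k))" "ln (\<Prod>k<l. b k) = (\<Sum>k<l. ln (b k))"
        by (auto intro!: ln_prod)
      ultimately have "(\<Sum>k<l. ln (a k)) \<le> (\<Sum>k<l. ln (b k))" by simp
      then show ?thesis by (simp add: d_def sum_subtractf)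
    qed
    have abel: "a l * (\<Sum>k<l. d k) \<le> (\<Sum>k<l. a k * d k)" if "l \<le> Suc m" for l
      using that
    proof (induction l)
      case (Suc l)
      have "a (Suc l) * (\<Sum>k<Suc l. d k) \<le> a l * (\<Sum>k<Suc l. d k)"
        by (intro mult_right_mono D antimonoD[OF assms(1)]) (use Suc in auto)
      also have "\<dots> \<le> (\<Sum>k<Suc l. a k * d k)" using Suc by (simp add: algebra_simps)
      finally show ?case .
    qed simp
    have "0 \<le> (\<Sum>k<Suc m. a k * d k)"
      using abel[of "Suc m"] mult_nonneg_nonneg[OF assms(2)[of "Suc m"] D[of "Suc m"]] by linarith
    also have "\<dots> \<le> (\<Sum>k<Suc m. b k - a k)"
    proof (rule sum_mono)
      fix k assume "k \<in> {..<Suc m}"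
      then have p: "0 < a k" "0 < b k" using pos bpos by auto
      have "d k \<le> b k / a k - 1" using ln_le_minus_one[of "b k / a k"] p by (simp add: d_def ln_div)
      then have "a k * d k \<le> a k * (b k / a k - 1)" using p by (intro mult_left_mono) auto
      then show "a k * d k \<le> b k - a k" using p by (simp add: algebra_simps)
    qed
    finally show ?thesis by (simp only: sum_subtractf)
  qed
qed simp

section \<open>Symmetric gauge functions\<close>

lemma fin_suppI: "(\<And>k. k \<ge> n \<Longrightarrow> x k = 0) \<Longrightarrow> fin_supp x"
  unfolding fin_supp_def by (rule finite_subset[of _ "{..<n}"]) (auto simp: not_less[symmetric])

lemma fin_supp_upd: "fin_supp x \<Longrightarrow> fin_supp (x(j := c))"
  unfolding fin_supp_def by (rule finite_subset[of _ "insert j {n. x n \<noteq> 0}"]) auto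

lemma fin_supp_le: "fin_supp y \<Longrightarrow> (\<And>k. y k = 0 \<Longrightarrow> x k = 0) \<Longrightarrow> fin_supp x"
  unfolding fin_supp_def by (erule rev_finite_subset) auto

lemma fin_supp_binop:
  assumes "fin_supp x" "fin_supp y" "f 0 0 = 0" shows "fin_supp (\<lambda>n. f (x n) (y n))"
proof -
  have "{n. f (x n) (y n) \<noteq> 0} \<subseteq> {n. x n \<noteq> 0} \<union> {n. y n \<noteq> 0}" using assms(3) by auto
  then show ?thesis using assms(1,2) unfolding fin_supp_def by (meson finite_UnI finite_subset)
qed

lemma
  assumes "sym_gauge \<Phi>" "fin_supp x"
  shows gauge_pos: "x \<noteq> (\<lambda>n. 0) \<Longrightarrow> 0 < \<Phi> x"
    and gauge_scale: "\<Phi> (\<lambda>n. c * x n) = \<bar>c\<bar> * \<Phi> x"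
    and gauge_triangle: "fin_supp y \<Longrightarrow> \<Phi> (\<lambda>n. x n + y n) \<le> \<Phi> x + \<Phi> y"
    and gauge_perm: "bij \<pi> \<Longrightarrow> \<Phi> (x \<circ> \<pi>) = \<Phi> x"
    and gauge_abs: "\<Phi> (\<lambda>n. \<bar>x n\<bar>) = \<Phi> x"
  using assms unfolding sym_gauge_def by simp_all

lemma gauge_zero: "sym_gauge \<Phi> \<Longrightarrow> \<Phi> (\<lambda>n. 0) = 0"
  using gauge_scale[of \<Phi> "\<lambda>n. 0" 0] by (simp add: fin_supp_def)

lemma gauge_nonneg: "sym_gauge \<Phi> \<Longrightarrow> fin_supp x \<Longrightarrow> 0 \<le> \<Phi> x"
  using gauge_zero[of \<Phi>] gauge_pos[of \<Phi> x] by (cases "x = (\<lambda>n. 0)") auto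

lemma gauge_combination:
  assumes "sym_gauge \<Phi>" "fin_supp x" "fin_supp y" "0 \<le> a" "0 \<le> b"
  shows "\<Phi> (\<lambda>n. a * x n + b * y n) \<le> a * \<Phi> x + b * \<Phi> y"
  using gauge_triangle[OF assms(1) fin_supp_le[OF assms(2), of "\<lambda>n. a * x n"]
      fin_supp_le[OF assms(3), of "\<lambda>n. b * y n"]] assms
  by (simp add: gauge_scale)

text \<open>With \<open>t = c / b j\<close>, the sequence \<open>b(j := c)\<close> is a convex
  combination, with weights \<open>(1 + t) / 2\<close> and \<open>(1 - t) / 2\<close>, of
  \<open>b\<close> and of \<open>b\<close> with its \<open>j\<close>-th sign flipped;
  \<open>\<Phi>\<close> agrees on these two.\<close>

lemma gauge_shrink:
  assumes "sym_gauge \<Phi>" "fin_supp b" "0 \<le> c" "c \<le> b j"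
  shows "\<Phi> (b(j := c)) \<le> \<Phi> b"
proof (cases "b j = 0")
  case True
  then show ?thesis using assms by (simp add: antisym fun_upd_idem)
next
  case False
  define t where "t = c / b j"
  have t: "0 \<le> t" "t \<le> 1" using assms False by (auto simp: t_def)
  have flip: "\<Phi> (b(j := - b j)) = \<Phi> b"
  proof -
    have "(\<lambda>n. \<bar>(b(j := - b j)) n\<bar>) = (\<lambda>n. \<bar>b n\<bar>)" by auto
    moreover have "fin_supp (b(j := - b j))" by (rule fin_supp_upd[OF assms(2)])
    ultimately show ?thesis using gauge_abs[OF assms(1)] assms(2) by metis
  qed
  have "\<Phi> (b(j := c)) = \<Phi> (\<lambda>n. (1 + t) / 2 * b n + (1 - t) / 2 * (b(j := - b j)) n)"
    using False by (intro arg_cong[of _ _ \<Phi>]) (auto simp: fun_eq_iff t_def field_simps)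
  also have "\<dots> \<le> (1 + t) / 2 * \<Phi> b + (1 - t) / 2 * \<Phi> (b(j := - b j))"
    by (rule gauge_combination[OF assms(1,2) fin_supp_upd[OF assms(2)]]) (use t in auto)
  also have "\<dots> = \<Phi> b" by (simp add: flip field_simps)
  finally show ?thesis .
qed

lemma gauge_mono:
  assumes "sym_gauge \<Phi>" "fin_supp b" "\<And>k. 0 \<le> a k" "\<And>k. a k \<le> b k"
  shows "\<Phi> a \<le> \<Phi> b"
  using assms(2,4)
proof (induction "card {k. a k \<noteq> b k}" arbitrary: b rule: less_induct)
  case less
  have fin: "finite {k. a k \<noteq> b k}"
    using less.prems(1) unfolding fin_supp_def
    by (rule rev_finite_subset) (use assms(3) less.prems(2) in \<open>auto intro: antisym\<close>, metis antisym)
  show ?case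
  proof (cases "a = b")
    case False
    then obtain j where j: "a j \<noteq> b j" by auto
    have "{k. a k \<noteq> (b(j := a j)) k} \<subset> {k. a k \<noteq> b k}" using j by auto
    then have "card {k. a k \<noteq> (b(j := a j)) k} < card {k. a k \<noteq> b k}" by (rule psubset_card_mono[OF fin])
    then have "\<Phi> a \<le> \<Phi> (b(j := a j))"
    proof (rule less.hyps)
      show "fin_supp (b(j := a j))" by (rule fin_supp_upd[OF less.prems(1)])
      show "a k \<le> (b(j := a j)) k" for k using less.prems(2) by simp
    qed
    also have "\<dots> \<le> \<Phi> b" by (rule gauge_shrink) (use assms less.prems in auto)
    finally show ?thesis .
  qed simp
qed

text \<open>The new sequence is a convex combination of \<open>b\<close> and its image under the
  transposition of \<open>j\<close> and \<open>k\<close>, with weight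
  \<open>\<delta> / (b j - b k)\<close> on the latter.\<close>

lemma gauge_transfer:
  assumes "sym_gauge \<Phi>" "fin_supp b" "j \<noteq> k" "0 \<le> \<delta>" "\<delta> \<le> b j - b k"
  shows "\<Phi> (b(j := b j - \<delta>, k := b k + \<delta>)) \<le> \<Phi> b"
proof (cases "b j = b k")
  case True
  then have "b(j := b j - \<delta>, k := b k + \<delta>) = b" using assms by auto
  then show ?thesis by simp
next
  case False
  define l where "l = \<delta> / (b j - b k)"
  have l: "0 \<le> l" "l \<le> 1" using assms False by (auto simp: l_def field_simps)
  have ld: "l * (b j - b k) = \<delta>" using False by (simp add: l_def)
  have perm: "\<Phi> (b \<circ> Transposition.transpose j k) = \<Phi> b"
    using assms(1,2) by (simp add: gauge_perm)
  have "fin_supp (b \<circ> Transposition.transpose j k)"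
  proof -
    have "{n. (b \<circ> Transposition.transpose j k) n \<noteq> 0} \<subseteq> Transposition.transpose j k ` {n. b n \<noteq> 0}"
      by (auto simp: image_iff) (metis transpose_involutory)
    then show ?thesis using assms(2) unfolding fin_supp_def by (meson finite_imageI finite_subset)
  qed
  then have "\<Phi> (\<lambda>n. (1 - l) * b n + l * (b \<circ> Transposition.transpose j k) n)
      \<le> (1 - l) * \<Phi> b + l * \<Phi> (b \<circ> Transposition.transpose j k)"
    by (rule gauge_combination[OF assms(1,2)]) (use l in simp_all)
  also have "\<dots> = \<Phi> b" by (simp add: perm algebra_simps)
  also have "(\<lambda>n. (1 - l) * b n + l * (b \<circ> Transposition.transpose j k) n) = b(j := b j - \<delta>, k := b k + \<delta>)"
    using assms(3) ld by (auto simp: fun_eq_iff algebra_simps transpose_def)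
  finally show ?thesis .
qed

text \<open>Each transfer makes \<open>b\<close> agree with \<open>a\<close> in one more coordinate.\<close>

lemma gauge_weak_majorization:
  assumes \<Phi>: "sym_gauge \<Phi>" and a: "antimono a" "\<And>k. 0 \<le> a k" "\<And>k. n \<le> k \<Longrightarrow> a k = 0"
    and b: "\<And>k. 0 \<le> b k" "\<And>k. n \<le> k \<Longrightarrow> b k = 0"
    and sums: "\<And>m. (\<Sum>k<m. a k) \<le> (\<Sum>k<m. b k)"
  shows "\<Phi> a \<le> \<Phi> b"
  using b sums
proof (induction "card {k. a k \<noteq> b k}" arbitrary: b rule: less_induct)
  case less
  note b = less.prems
  have fb: "fin_supp b" by (rule fin_suppI[OF b(2)])
  have fin: "finite {k. a k \<noteq> b k}"
    by (rule finite_subset[of _ "{..<n}"], rule subsetI, simp) (metis a(3) b(2) not_le, simp)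
  show ?case
  proof (cases "\<forall>k. a k \<le> b k")
    case True
    then show ?thesis by (intro gauge_mono[OF \<Phi> fb a(2)]) auto
  next
    case False
    \<comment> \<open>At the first deficit \<open>k\<close> the partial sums force an earlier
      surplus \<open>j\<close>; as \<open>a\<close> decreases,
      \<open>b j > a j >= a k > b k\<close>, so mass may flow from \<open>j\<close> to
      \<open>k\<close>.\<close>
    define k where "k = (LEAST k. b k < a k)"
    have k: "b k < a k" unfolding k_def by (rule LeastI_ex) (use False in \<open>auto simp: not_le\<close>)
    have below: "a i \<le> b i" if "i < k" for i using not_less_Least[OF that[unfolded k_def]] by simp
    have "\<exists>j<k. a j < b j"
    proof (rule ccontr)
      assume "\<not> ?thesis"
      then have "(\<Sum>i<k. b i) \<le> (\<Sum>i<k. a i)" by (intro sum_mono) (metis lessThan_iff not_le)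
      then show False using b(3)[of "Suc k"] k by simp
    qed
    then obtain j where j: "j < k" "a j < b j" by blast
    have ajk: "a k \<le> a j" using antimonoD[OF a(1)] j by simp
    \<comment> \<open>The largest amount that overshoots neither \<open>a j\<close> nor
      \<open>a k\<close>; attaining one of them makes the induction measure drop.\<close>
    define \<delta> where "\<delta> = min (b j - a j) (a k - b k)"
    have \<delta>: "0 < \<delta>" "\<delta> \<le> b j - a j" "\<delta> \<le> a k - b k" "\<delta> = b j - a j \<or> \<delta> = a k - b k"
      using j k by (auto simp: \<delta>_def)
    define b' where "b' = b(j := b j - \<delta>, k := b k + \<delta>)"
    have "\<Phi> a \<le> \<Phi> b'"
    proof (rule less.hyps)
      have "{i. a i \<noteq> b' i} \<subset> {i. a i \<noteq> b i}" using j k \<delta> by (auto simp: b'_def split: if_splits)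
      then show "card {i. a i \<noteq> b' i} < card {i. a i \<noteq> b i}" by (rule psubset_card_mono[OF fin])
      show "0 \<le> b' i" for i using b(1) \<delta> j a(2)[of j] by (simp add: b'_def)
      have "k < n" using k a(3) b(1)[of k] by (metis not_le not_less)
      then show "n \<le> i \<Longrightarrow> b' i = 0" for i using b(2) j by (simp add: b'_def)
      show "(\<Sum>i<m. a i) \<le> (\<Sum>i<m. b' i)" for m
      proof -
        have "(\<Sum>i<m. b' i) = (\<Sum>i<m. b i + (if i = k then \<delta> else 0) - (if i = j then \<delta> else 0))"
          using j by (intro sum.cong) (auto simp: b'_def)
        also have "\<dots> = (\<Sum>i<m. b i) + (if k < m then \<delta> else 0) - (if j < m then \<delta> else 0)"
          by (simp add: sum.distrib sum_subtractf)
        finally have eq: "(\<Sum>i<m. b' i) = (\<Sum>i<m. b i) + (if k < m then \<delta> else 0) - (if j < m then \<delta> else 0)" .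
        \<comment> \<open>Only the partial sums with \<open>j < m\<close> and \<open>m <= k\<close>
          fall, by \<open>\<delta>\<close>; there \<open>a i <= b i\<close> for all
          \<open>i < m\<close>, so the surplus at \<open>j\<close> alone covers the loss.\<close>
        show ?thesis
        proof (cases "j < m \<and> m \<le> k")
          case True
          have "b j - a j \<le> (\<Sum>i<m. b i - a i)"
            by (rule member_le_sum) (use True below in auto)
          then show ?thesis using eq True \<delta>(2) by (simp add: sum_subtractf)
        next
          case False
          then show ?thesis using eq b(3)[of m] \<delta>(1) j by auto
        qed
      qed
    qed
    also have "\<Phi> b' \<le> \<Phi> b"
      unfolding b'_def by (rule gauge_transfer) (use \<Phi> fb j k \<delta> ajk in auto)
    finally show ?thesis .
  qed
qed

text \<open>Arithmetic-geometric mean with the weight \<open>r\<close> chosen so that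
  \<open>r * \<Phi> p\<close> and \<open>\<Phi> q / r\<close> are equal. If a gauge vanishes, its
  sequence is zero.\<close>

lemma gauge_geometric_mean:
  assumes \<Phi>: "sym_gauge \<Phi>" and p: "fin_supp p" "\<And>k. 0 \<le> p k" and q: "fin_supp q" "\<And>k. 0 \<le> q k"
  shows "\<Phi> (\<lambda>k. sqrt (p k * q k)) \<le> sqrt (\<Phi> p) * sqrt (\<Phi> q)"
proof (cases "\<Phi> p = 0 \<or> \<Phi> q = 0")
  case True
  then have "p = (\<lambda>n. 0) \<or> q = (\<lambda>n. 0)" using gauge_pos[OF \<Phi>] p(1) q(1) by (metis less_irrefl)
  then show ?thesis using gauge_zero[OF \<Phi>] gauge_nonneg[OF \<Phi>] p(1) q(1) by auto
next
  case False
  then have pos: "0 < \<Phi> p" "0 < \<Phi> q" using gauge_nonneg[OF \<Phi> p(1)] gauge_nonneg[OF \<Phi> q(1)] by auto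
  define r where "r = sqrt (\<Phi> q) / sqrt (\<Phi> p)"
  have r: "0 < r" using pos by (simp add: r_def)
  have "sqrt (p k * q k) \<le> r / 2 * p k + 1 / (2 * r) * q k" for k
  proof -
    have "sqrt (p k * q k) = sqrt ((r * p k) * (q k / r))" using r by simp
    also have "\<dots> \<le> (r * p k + q k / r) / 2" by (rule arith_geo_mean_sqrt) (use p q r in auto)
    finally show ?thesis by (simp add: add_divide_distrib)
  qed
  then have "\<Phi> (\<lambda>k. sqrt (p k * q k)) \<le> \<Phi> (\<lambda>k. r / 2 * p k + 1 / (2 * r) * q k)"
    by (intro gauge_mono[OF \<Phi> fin_supp_binop[OF p(1) q(1)]]) (use p q in auto)
  also have "\<dots> \<le> r / 2 * \<Phi> p + 1 / (2 * r) * \<Phi> q"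
    by (rule gauge_combination) (use \<Phi> p q r in auto)
  also have "r / 2 * \<Phi> p = sqrt (\<Phi> p) * sqrt (\<Phi> q) / 2"
    using pos by (simp add: r_def field_simps)
  also have "1 / (2 * r) * \<Phi> q = sqrt (\<Phi> p) * sqrt (\<Phi> q) / 2"
    using pos by (simp add: r_def field_simps)
  finally show ?thesis by simp
qed

lemma gauge_truncation_le:
  assumes \<Phi>: "sym_gauge \<Phi>" and a: "antimono a" "\<And>k. 0 \<le> a k"
    and p: "\<And>k. 0 \<le> p k" and q: "\<And>k. 0 \<le> q k"
    and prods: "\<And>m. (\<Prod>k<m. a k) \<le> (\<Prod>k<m. sqrt (p k * q k))"
  shows "\<Phi> (\<lambda>k. if k < n then a k else 0)
    \<le> sqrt (\<Phi> (\<lambda>k. if k < n then p k else 0)) * sqrt (\<Phi> (\<lambda>k. if k < n then q k else 0))"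
proof -
  have "\<Phi> (\<lambda>k. if k < n then a k else 0) \<le> \<Phi> (\<lambda>k. if k < n then sqrt (p k * q k) else 0)"
  proof (rule gauge_weak_majorization[OF \<Phi>, where n = n])
    show "antimono (\<lambda>k. if k < n then a k else 0)" using a by (auto simp: antimono_def)
    have trunc: "(\<Sum>k<m. if k < n then f k else 0) = (\<Sum>k<min m n. f k)" for f :: "nat \<Rightarrow> real" and m
    proof -
      have "(\<Sum>k<min m n. f k) = (\<Sum>k<min m n. if k < n then f k else 0)" by (rule sum.cong) auto
      also have "\<dots> = (\<Sum>k<m. if k < n then f k else 0)" by (rule sum.mono_neutral_left) auto
      finally show ?thesis by simp
    qed
    show "(\<Sum>k<m. if k < n then a k else 0) \<le> (\<Sum>k<m. if k < n then sqrt (p k * q k) else 0)" for m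
      unfolding trunc by (rule sum_le_of_prod_le) (use a p q prods in auto)
  qed (use a p q in auto)
  also have "(\<lambda>k. if k < n then sqrt (p k * q k) else 0)
      = (\<lambda>k. sqrt ((if k < n then p k else 0) * (if k < n then q k else 0)))"
    by auto
  also have "\<Phi> \<dots> \<le> sqrt (\<Phi> (\<lambda>k. if k < n then p k else 0)) * sqrt (\<Phi> (\<lambda>k. if k < n then q k else 0))"
    by (rule gauge_geometric_mean[OF \<Phi>]) (auto intro!: fin_suppI[of n] simp: p q)
  finally show ?thesis .
qed

subsection \<open>Compactness and approximation numbers\<close>

lemma compact_bounded_combinations:
  fixes w :: "nat \<Rightarrow> 'a::complex_hilbert"
  shows "\<exists>Z. compact Z \<and> (\<forall>c. (\<forall>i<n. cmod (c i) \<le> K) \<longrightarrow> (\<Sum>i<n. scaleC (c i) (w i)) \<in> Z)"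
proof (induction n)
  case 0
  show ?case by (rule exI[of _ "{0}"]) simp
next
  case (Suc n)
  then obtain Z where Z: "compact Z" "\<And>c. (\<forall>i<n. cmod (c i) \<le> K) \<Longrightarrow> (\<Sum>i<n. scaleC (c i) (w i)) \<in> Z"
    by blast
  let ?D = "(\<lambda>z. scaleC z (w n)) ` cball 0 K"
  have "compact ?D"
    by (intro compact_continuous_image bounded_linear.continuous_on[OF scaleC.bounded_linear_left]
        continuous_on_id compact_cball)
  then have "compact {x + y | x y. x \<in> Z \<and> y \<in> ?D}" by (rule compact_sums[OF Z(1)])
  moreover have "(\<Sum>i<Suc n. scaleC (c i) (w i)) \<in> {x + y | x y. x \<in> Z \<and> y \<in> ?D}"
    if "\<forall>i<Suc n. cmod (c i) \<le> K" for c
  proof -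
    have "scaleC (c n) (w n) \<in> ?D" using that by auto
    moreover have "(\<Sum>i<n. scaleC (c i) (w i)) \<in> Z" using Z(2) that by simp
    ultimately show ?thesis unfolding sum.lessThan_Suc by blast
  qed
  ultimately show ?case by blast
qed

text \<open>Projecting onto the span of a finite net of the image of the unit ball leaves an error
  of at most the mesh \<open>e\<close>.\<close>

lemma compact_op_sval_tendsto_0:
  assumes "compact_op T" shows "sval T \<longlonglongrightarrow> 0"
proof (rule LIMSEQ_I)
  fix r :: real assume r: "0 < r"
  define e where "e = r / 2"
  have e: "0 < e" using r by (simp add: e_def)
  have bT: "bop T" and cT: "compact (closure (T ` {x. norm x \<le> 1}))"
    using assms by (auto simp: compact_op_def)
  obtain k where k: "finite k" "closure (T ` {x. norm x \<le> 1}) \<subseteq> (\<Union>x\<in>k. ball x e)"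
    using cT e unfolding compact_eq_totally_bounded by blast
  obtain v where v: "bij_betw v {0..<card k} k" using ex_bij_betw_nat_finite[OF k(1)] by blast
  obtain w where w: "ons w (card k)" "\<And>i. i < card k \<Longrightarrow> proj w (card k) (v i) = v i"
    using Gram_Schmidt[of "card k" v] by blast
  have unit: "norm (T x - proj w (card k) (T x)) \<le> e" if "norm x \<le> 1" for x
  proof -
    have "T x \<in> T ` {x. norm x \<le> 1}" using that by simp
    then have "T x \<in> (\<Union>x\<in>k. ball x e)" by (rule subsetD[OF k(2) subsetD[OF closure_subset]])
    then obtain y where y: "y \<in> k" "dist y (T x) < e" by auto
    have "y \<in> v ` {0..<card k}" using v y(1) by (simp add: bij_betw_def)
    then obtain i where i: "i < card k" "y = v i" by auto
    then show ?thesis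
      using norm_minus_proj_best[OF w(1), of "T x" "v i"] w(2)[OF i(1)] y(2)
      by (simp add: dist_norm norm_minus_commute)
  qed
  define S where "S = (\<lambda>x. T x - proj w (card k) (T x))"
  have bS: "bop S" unfolding S_def by (rule bop_minus_op[OF bT bop_compose[OF bop_proj bT]])
  have "norm (S x) \<le> e * norm x" for x
  proof (cases "x = 0")
    case False
    have "norm (S (inverse (norm x) *\<^sub>R x)) \<le> e" unfolding S_def by (rule unit) (use False in simp)
    then show ?thesis using False by (simp add: bop_scaleR[OF bS] field_simps)
  qed (simp add: bop_0[OF bS])
  then have "sval T (card k) \<le> e"
    using e by (intro sval_le_range[OF bT, where w = w]) (auto simp: S_def)
  then have "norm (sval T n - 0) < r" if "card k \<le> n" for n
    using antimonoD[OF sval_antimono[OF bT] that] sval_nonneg[OF bT, of n] r by (simp add: e_def)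
  then show "\<exists>no. \<forall>n\<ge>no. norm (sval T n - 0) < r" by blast
qed

text \<open>Up to a small error the image of the unit ball lies in a bounded subset of a
  finite-dimensional space, which \<open>compact_bounded_combinations\<close> puts into a compact
  set; total boundedness follows.\<close>

lemma compact_op_of_sval_tendsto_0:
  assumes T: "bop T" and lim: "sval T \<longlonglongrightarrow> 0" shows "compact_op T"
proof -
  let ?S = "T ` {x. norm x \<le> 1}"
  have "\<exists>k. finite k \<and> closure ?S \<subseteq> (\<Union>x\<in>k. ball x e)" if "0 < e" for e
  proof -
    have "0 < e / 3" using that by simp
    then obtain n where "norm (sval T n - 0) < e / 3" using LIMSEQ_D[OF lim] by blast
    then have "sval T n < e / 3" by simp
    from sval_range[OF T this]
    obtain w where w: "ons w n" "\<And>x. norm (T x - proj w n (T x)) \<le> e / 3 * norm x" by metis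
    obtain Z where Z: "compact Z"
      "\<And>c. (\<forall>i<n. cmod (c i) \<le> onorm T) \<Longrightarrow> (\<Sum>i<n. scaleC (c i) (w i)) \<in> Z"
      using compact_bounded_combinations[of n "onorm T" w] by blast
    have "\<exists>k. finite k \<and> Z \<subseteq> (\<Union>x\<in>k. ball x (e / 3))"
      using Z(1)[unfolded compact_eq_totally_bounded, THEN conjunct2, rule_format, of "e / 3"] that by simp
    then obtain k where k: "finite k" "Z \<subseteq> (\<Union>x\<in>k. ball x (e / 3))" by blast
    \<comment> \<open>Closed balls of radius \<open>2 * e / 3\<close> make the covering set closed,
      so it contains the closure as well; they still fit into open balls of radius
      \<open>e\<close>.\<close>
    have "?S \<subseteq> (\<Union>y\<in>k. cball y (2 * e / 3))"
    proof
      fix z assume "z \<in> ?S"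
      then obtain x where x: "z = T x" "norm x \<le> 1" by blast
      have "cmod (cinner (T x) (w i)) \<le> onorm T" if "i < n" for i
      proof -
        have "cmod (cinner (T x) (w i)) \<le> norm (T x) * norm (w i)" by (rule cinner_Cauchy_Schwarz)
        also have "\<dots> \<le> norm (T x) * 1"
        proof (rule mult_left_mono)
          have "norm (w i) = 1 \<or> w i = 0" using w(1) that by (simp add: ons_def)
          then show "norm (w i) \<le> 1" by auto
        qed simp
        also have "\<dots> \<le> onorm T * norm x" using bop_onorm[OF T] by simp
        also have "\<dots> \<le> onorm T * 1" by (intro mult_left_mono x bop_onorm_nonneg T)
        finally show ?thesis by simp
      qed
      then have "proj w n (T x) \<in> Z" unfolding proj_def by (intro Z(2)) blast
      then obtain y where y: "y \<in> k" "dist y (proj w n (T x)) < e / 3" using k(2) by auto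
      have "norm (T x - proj w n (T x)) \<le> e / 3 * 1"
        using w(2)[of x] mult_left_mono[OF x(2), of "e / 3"] that by linarith
      then have "dist y (T x) \<le> 2 * e / 3"
        using y(2) dist_triangle[of y "T x" "proj w n (T x)"]
        by (simp add: dist_norm norm_minus_commute)
      then show "z \<in> (\<Union>y\<in>k. cball y (2 * e / 3))" using x(1) y(1) by auto
    qed
    moreover have "closed (\<Union>y\<in>k. cball y (2 * e / 3))" using k(1) by (intro closed_UN) auto
    ultimately have "closure ?S \<subseteq> (\<Union>y\<in>k. cball y (2 * e / 3))" by (rule closure_minimal)
    also have "\<dots> \<subseteq> (\<Union>y\<in>k. ball y e)" using that by (intro UN_mono) auto
    finally show ?thesis using k(1) by blast
  qed
  then have "compact (closure ?S)"
    unfolding compact_eq_totally_bounded by (simp add: complete_eq_closed)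
  then show ?thesis using T by (simp add: compact_op_def)
qed

subsection \<open>Weak measurability\<close>

text \<open>By separability the norm is a countable supremum of the functions
  \<open>cmod (cinner (u t) d) / norm d\<close>.\<close>

lemma measurable_norm_of_weakly_measurable:
  fixes u :: "'t \<Rightarrow> 'a::complex_hilbert"
  assumes "\<And>g. (\<lambda>t. cinner (u t) g) \<in> borel_measurable M"
  shows "(\<lambda>t. norm (u t)) \<in> borel_measurable M"
proof -
  obtain D :: "'a set" where D: "countable D" "\<And>x e. 0 < e \<Longrightarrow> \<exists>d\<in>D. norm (x - d) < e"
    using separable by blast
  have dense: "closure D = UNIV"
    using D(2) by (auto simp: closure_approachable dist_norm norm_minus_commute)
  have Dne: "D \<noteq> {}" using D(2)[of 1 0] by auto
  have bd: "cmod (cinner v d) / norm d \<le> norm v" for v d :: 'a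
    using cinner_Cauchy_Schwarz[of v d] by (cases "d = 0") (auto simp: field_simps)
  have bdd: "bdd_above ((\<lambda>d. cmod (cinner v d) / norm d) ` D)" for v
    by (rule bdd_aboveI2[OF bd])
  have sup: "norm v = (SUP d\<in>D. cmod (cinner v d) / norm d)" for v
  proof (rule antisym)
    define s where "s = (SUP d\<in>D. cmod (cinner v d) / norm d)"
    have up: "cmod (cinner v d) / norm d \<le> s" if "d \<in> D" for d
      unfolding s_def by (rule cSUP_upper[OF that bdd])
    \<comment> \<open>The bound by \<open>s\<close> is a closed condition valid on the dense set
      \<open>D\<close>, hence it holds at \<open>v\<close> itself.\<close>
    have s0: "0 \<le> s" using up Dne by (meson divide_nonneg_nonneg ex_in_conv norm_ge_zero order_trans)
    have "closed {x. cmod (cinner v x) \<le> s * norm x}"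
      by (intro closed_Collect_le continuous_intros bounded_linear.continuous_on[OF cinner.bounded_linear_right])
    moreover have "D \<subseteq> {x. cmod (cinner v x) \<le> s * norm x}"
    proof
      fix d assume "d \<in> D"
      from up[OF this] show "d \<in> {x. cmod (cinner v x) \<le> s * norm x}"
        by (cases "d = 0") (auto simp: pos_divide_le_eq cinner.zero_right)
    qed
    ultimately have "v \<in> {x. cmod (cinner v x) \<le> s * norm x}"
      using closure_minimal dense by (metis UNIV_I subsetD)
    then have "norm v * norm v \<le> s * norm v" by (simp add: cinner_self norm_power power2_eq_square norm_mult)
    then show "norm v \<le> (SUP d\<in>D. cmod (cinner v d) / norm d)"
      using s0 unfolding s_def[symmetric] by (cases "v = 0") auto
    show "(SUP d\<in>D. cmod (cinner v d) / norm d) \<le> norm v"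
      by (rule cSUP_least[OF Dne bd])
  qed
  have "(\<lambda>t. norm (u t)) = (\<lambda>t. SUP d\<in>D. cmod (cinner (u t) d) / norm d)"
    by (rule ext) (rule sup)
  also have "\<dots> \<in> borel_measurable M"
    by (rule borel_measurable_cSUP[OF D(1)
          borel_measurable_divide[OF measurable_compose[OF assms borel_measurable_norm] borel_measurable_const] bdd])
  finally show ?thesis .
qed

text \<open>Polarisation reduces the claim to norms of \<open>u t + scaleC c (v t)\<close>, which is
  again weakly measurable.\<close>

lemma measurable_cinner_of_weakly_measurable:
  fixes u v :: "'t \<Rightarrow> 'a::complex_hilbert"
  assumes u: "\<And>g. (\<lambda>t. cinner (u t) g) \<in> borel_measurable M"
    and v: "\<And>g. (\<lambda>t. cinner (v t) g) \<in> borel_measurable M"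
  shows "(\<lambda>t. cinner (u t) (v t)) \<in> borel_measurable M"
proof -
  have n: "(\<lambda>t. norm (u t + scaleC c (v t))) \<in> borel_measurable M" for c
    by (rule measurable_norm_of_weakly_measurable)
       (use u v in \<open>simp add: cinner.add_left cinner_scaleC_left\<close>)
  have Re: "Re (cinner x y) = ((norm (x + scaleC 1 y))\<^sup>2 - (norm (x + scaleC (- 1) y))\<^sup>2) / 4" for x y :: 'a
    by (simp add: scaleC_one scaleC.minus_left power2_norm_add power2_norm_diff)
  have "scaleC (- \<i>) y = - scaleC \<i> y" for y :: 'a by (rule scaleC.minus_left)
  then have Im: "Im (cinner x y) = ((norm (x + scaleC \<i> y))\<^sup>2 - (norm (x + scaleC (- \<i>) y))\<^sup>2) / 4" for x y :: 'a
    by (simp add: power2_norm_add power2_norm_diff cinner_scaleC_right)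
  show ?thesis unfolding borel_measurable_complex_iff Re Im
    by (intro conjI borel_measurable_divide borel_measurable_diff borel_measurable_power n
        borel_measurable_const)
qed

text \<open>Polarisation of the quadratic form of \<open>A t\<close>, whose linearity is available
  for \<open>t\<close> in \<open>space M\<close>.\<close>

lemma wstar_measurable_weak:
  assumes "wstar_measurable M A"
  shows "(\<lambda>t. cinner (A t f) g) \<in> borel_measurable M"
proof -
  have m: "(\<lambda>t. cinner (A t h) h) \<in> borel_measurable M" for h
    using assms by (simp add: wstar_measurable_def)
  let ?q = "\<lambda>t h. cinner (A t h) h"
  have eq: "cinner (A t f) g = (?q t (f + g) - ?q t (f - g)
      + \<i> * (?q t (f + scaleC \<i> g) - ?q t (f - scaleC \<i> g))) / 4" if "t \<in> space M" for t
  proof -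
    have b: "bop (A t)" using assms that by (simp add: wstar_measurable_def)
    show ?thesis
      by (simp add: bop_add[OF b] bop_diff[OF b] bop_scaleC[OF b] cinner.add_left cinner.add_right
          cinner.diff_left cinner.diff_right cinner_scaleC_left cinner_scaleC_right algebra_simps)
  qed
  have "(\<lambda>t. (?q t (f + g) - ?q t (f - g)
      + \<i> * (?q t (f + scaleC \<i> g) - ?q t (f - scaleC \<i> g))) / 4) \<in> borel_measurable M"
    by (intro borel_measurable_divide borel_measurable_add borel_measurable_diff borel_measurable_times
        borel_measurable_const m)
  then show ?thesis using eq by (subst measurable_cong) auto
qed

subsection \<open>Gel'fand integrals of products\<close>

locale square_integrable_field =
  fixes M :: "'t measure" and A :: "'t \<Rightarrow> 'h::complex_hilbert \<Rightarrow> 'h" and IA :: "'h \<Rightarrow> 'h"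
  assumes wstar: "wstar_measurable M A"
    and gelfand: "has_gelfand_integral M (\<lambda>t. opabs (A t) \<circ> opabs (A t)) IA"
begin

lemma bop: "t \<in> space M \<Longrightarrow> bop (A t)"
  using wstar by (simp add: wstar_measurable_def)

lemma bop_integral: "bop IA"
  using gelfand by (simp add: has_gelfand_integral_def)

lemma cinner_abs_square:
  "t \<in> space M \<Longrightarrow> cinner ((opabs (A t) \<circ> opabs (A t)) f) g = cinner (A t f) (A t g)"
  by (simp add: opabs_opabs bop cinner_adj_left)

lemma integrable_cinner: "integrable M (\<lambda>t. cinner (A t f) (A t g))"
  using gelfand unfolding has_gelfand_integral_def
  by (metis (no_types, lifting) Bochner_Integration.integrable_cong cinner_abs_square)

lemma integral_cinner: "(\<integral>t. cinner (A t f) (A t g) \<partial>M) = cinner (IA f) g"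
  using gelfand unfolding has_gelfand_integral_def
  by (metis (no_types, lifting) Bochner_Integration.integral_cong cinner_abs_square)

lemma has_gelfand_adj: "has_gelfand_integral M (\<lambda>t. adj (A t) \<circ> A t) IA"
proof -
  have eq: "cinner ((adj (A t) \<circ> A t) f) g = cinner (A t f) (A t g)" if "t \<in> space M" for t f g
    by (simp add: cinner_adj_left bop that)
  show ?thesis unfolding has_gelfand_integral_def
    using bop_integral integrable_cinner integral_cinner eq
    by (simp cong: Bochner_Integration.integrable_cong Bochner_Integration.integral_cong)
qed

lemma integrable_norm2: "integrable M (\<lambda>t. (norm (A t f))\<^sup>2)"
  using integrable_Re[OF integrable_cinner[of f f]] by (simp add: Re_cinner_self)

lemma integral_norm2: "(\<integral>t. (norm (A t f))\<^sup>2 \<partial>M) = Re (cinner (IA f) f)"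
  using integral_Re[OF integrable_cinner[of f f]] by (simp add: Re_cinner_self integral_cinner)

lemma posop_integral: "posop IA"
proof -
  have "cinner (IA x) y = cinner x (IA y)" for x y
  proof -
    have "cinner x (IA y) = cnj (\<integral>t. cinner (A t y) (A t x) \<partial>M)"
      by (simp add: integral_cinner cinner_commute[of x])
    also have "\<dots> = (\<integral>t. cnj (cinner (A t y) (A t x)) \<partial>M)" by simp
    also have "\<dots> = cinner (IA x) y" by (simp add: cinner_commute[symmetric] integral_cinner)
    finally show ?thesis by simp
  qed
  moreover have "0 \<le> Re (cinner (IA x) x)" for x
    unfolding integral_norm2[symmetric] by (rule integral_nonneg_AE) simp
  ultimately show ?thesis using bop_integral by (simp add: posop_def)
qed

end

text \<open>\<open>I\<close> is the Riesz representative of the sesquilinear form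
  \<open>F f g\<close>, the integral of \<open>cinner (B t f) (A t g)\<close>. The Cauchy-Schwarz
  bound for \<open>F\<close> makes \<open>I\<close> bounded, and it is through this bound that
  \<open>IA\<close> and \<open>IB\<close> later control \<open>I\<close>.\<close>

lemma gelfand_integral_product:
  fixes A B :: "'t \<Rightarrow> 'h::complex_hilbert \<Rightarrow> 'h"
  assumes "square_integrable_field M A IA" "square_integrable_field M B IB"
  obtains I where "has_gelfand_integral M (\<lambda>t. adj (A t) \<circ> B t) I"
    and "\<And>f g. (cmod (cinner (I f) g))\<^sup>2 \<le> Re (cinner (IB f) f) * Re (cinner (IA g) g)"
proof -
  interpret A: square_integrable_field M A IA by fact
  interpret B: square_integrable_field M B IB by fact
  define F where "F = (\<lambda>f g. \<integral>t. cinner (B t f) (A t g) \<partial>M)"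
  have int: "integrable M (\<lambda>t. cinner (B t f) (A t g))" for f g
  proof (rule Bochner_Integration.integrable_bound)
    show "integrable M (\<lambda>t. (norm (B t f))\<^sup>2 + (norm (A t g))\<^sup>2)"
      by (intro Bochner_Integration.integrable_add A.integrable_norm2 B.integrable_norm2)
    show "(\<lambda>t. cinner (B t f) (A t g)) \<in> borel_measurable M"
      by (rule measurable_cinner_of_weakly_measurable[OF wstar_measurable_weak[OF B.wstar]
            wstar_measurable_weak[OF A.wstar]])
    have "cmod (cinner x y) \<le> (norm x)\<^sup>2 + (norm y)\<^sup>2" for x y :: 'h
    proof -
      have "0 \<le> norm x * norm y" by simp
      then show ?thesis
        using cinner_Cauchy_Schwarz[of x y] sum_squares_bound[of "norm x" "norm y"] by linarith
    qed
    then show "AE t in M. norm (cinner (B t f) (A t g)) \<le> norm ((norm (B t f))\<^sup>2 + (norm (A t g))\<^sup>2)"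
      by simp
  qed
  have CS: "(cmod (F f g))\<^sup>2 \<le> Re (cinner (IB f) f) * Re (cinner (IA g) g)" for f g
  proof (rule Cauchy_Schwarz_of_form)
    fix c
    have "0 \<le> (\<integral>t. (norm (B t f + scaleC c (A t g)))\<^sup>2 \<partial>M)" by (rule integral_nonneg_AE) simp
    also have "\<dots> = (\<integral>t. (norm (B t f))\<^sup>2 + (cmod c)\<^sup>2 * (norm (A t g))\<^sup>2
        + 2 * Re (cnj c * cinner (B t f) (A t g)) \<partial>M)"
      by (simp add: power2_norm_add norm_scaleC power_mult_distrib cinner_scaleC_right)
    also have "\<dots> = Re (cinner (IB f) f) + (cmod c)\<^sup>2 * Re (cinner (IA g) g) + 2 * Re (cnj c * F f g)"
    proof -
      have i: "integrable M (\<lambda>t. cnj c * cinner (B t f) (A t g))"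
        by (intro Bochner_Integration.integrable_mult_right int)
      have "(\<integral>t. Re (cnj c * cinner (B t f) (A t g)) \<partial>M) = Re (cnj c * F f g)"
        unfolding F_def using integral_Re[OF i] by (simp add: int)
      then show ?thesis
        using integrable_Re[OF i] A.integrable_norm2[of g] B.integrable_norm2[of f]
        by (simp add: A.integral_norm2 B.integral_norm2 del: times_complex.sel)
    qed
    finally show "0 \<le> Re (cinner (IB f) f) + (cmod c)\<^sup>2 * Re (cinner (IA g) g) + 2 * Re (cnj c * F f g)" .
  qed (use A.posop_integral B.posop_integral in \<open>auto simp: posop_def\<close>)
  have form_le: "Re (cinner (P x) x) \<le> onorm P * (norm x)\<^sup>2" if "bop P" for P and x :: 'h
  proof -
    have "Re (cinner (P x) x) \<le> norm (P x) * norm x"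
      by (meson cinner_Cauchy_Schwarz complex_Re_le_cmod order_trans)
    also have "\<dots> \<le> (onorm P * norm x) * norm x" by (intro mult_right_mono bop_onorm that) simp
    finally show ?thesis by (simp add: power2_eq_square)
  qed
  define K where "K = sqrt (onorm IB * onorm IA)"
  have K0: "0 \<le> onorm IB" "0 \<le> onorm IA"
    using A.bop_integral B.bop_integral by (simp_all add: bop_onorm_nonneg)
  have F_le: "cmod (F f g) \<le> K * norm f * norm g" for f g
  proof (rule power2_le_imp_le)
    have "(cmod (F f g))\<^sup>2 \<le> Re (cinner (IB f) f) * Re (cinner (IA g) g)" by (rule CS)
    also have "\<dots> \<le> (onorm IB * (norm f)\<^sup>2) * (onorm IA * (norm g)\<^sup>2)"
      by (intro mult_mono form_le A.bop_integral B.bop_integral mult_nonneg_nonneg K0)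
         (use A.posop_integral in \<open>auto simp: posop_def\<close>)
    also have "\<dots> = (K * norm f * norm g)\<^sup>2" using K0 by (simp add: K_def power_mult_distrib)
    finally show "(cmod (F f g))\<^sup>2 \<le> (K * norm f * norm g)\<^sup>2" .
  qed (use K0 in \<open>simp add: K_def\<close>)
  have F_add: "F f (g + h) = F f g + F f h" "F (g + h) f = F g f + F h f" for f g h
  proof -
    have "F f (g + h) = (\<integral>t. cinner (B t f) (A t g) + cinner (B t f) (A t h) \<partial>M)"
      unfolding F_def by (rule Bochner_Integration.integral_cong) (auto simp: A.bop bop_add cinner.add_right)
    then show "F f (g + h) = F f g + F f h" unfolding F_def by (simp add: int)
    have "F (g + h) f = (\<integral>t. cinner (B t g) (A t f) + cinner (B t h) (A t f) \<partial>M)"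
      unfolding F_def by (rule Bochner_Integration.integral_cong) (auto simp: B.bop bop_add cinner.add_left)
    then show "F (g + h) f = F g f + F h f" unfolding F_def by (simp add: int)
  qed
  have F_scale: "F f (scaleC c g) = cnj c * F f g" "F (scaleC c f) g = c * F f g" for f g c
  proof -
    have "F f (scaleC c g) = (\<integral>t. cnj c * cinner (B t f) (A t g) \<partial>M)"
      unfolding F_def by (rule Bochner_Integration.integral_cong) (auto simp: A.bop bop_scaleC cinner_scaleC_right)
    then show "F f (scaleC c g) = cnj c * F f g" unfolding F_def by simp
    have "F (scaleC c f) g = (\<integral>t. c * cinner (B t f) (A t g) \<partial>M)"
      unfolding F_def by (rule Bochner_Integration.integral_cong) (auto simp: B.bop bop_scaleC cinner_scaleC_left)
    then show "F (scaleC c f) g = c * F f g" unfolding F_def by simp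
  qed
  \<comment> \<open>\<open>F f\<close> is conjugate-linear in \<open>g\<close>, so its conjugate is
    the functional to represent.\<close>
  have "\<exists>z. \<forall>g. cnj (F f g) = cinner g z" for f
    by (rule Riesz_representation[where K = "K * norm f"]) (auto simp: F_add F_scale F_le)
  then obtain I where I: "\<And>f g. cnj (F f g) = cinner g (I f)" by metis
  have IF: "cinner (I f) g = F f g" for f g
    by (subst cinner_commute) (simp add: I[symmetric])
  have "bop I"
  proof (rule bopI)
    fix x y c
    show "I (x + y) = I x + I y" by (rule cinner_ext_left) (simp add: cinner.add_left IF F_add)
    show "I (scaleC c x) = scaleC c (I x)" by (rule cinner_ext_left) (simp add: cinner_scaleC_left IF F_scale)
    have "cmod (cinner (I x) (I x)) \<le> K * norm x * norm (I x)" unfolding IF by (rule F_le)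
    then have "norm (I x) * norm (I x) \<le> (K * norm x) * norm (I x)"
      by (simp add: cinner_self power2_eq_square norm_mult)
    then show "norm (I x) \<le> K * norm x" using K0 by (cases "I x = 0") (auto simp: K_def)
  qed
  moreover have "cinner ((adj (A t) \<circ> B t) f) g = cinner (B t f) (A t g)" if "t \<in> space M" for t f g
    by (simp add: cinner_adj_left A.bop that)
  ultimately have "has_gelfand_integral M (\<lambda>t. adj (A t) \<circ> B t) I"
    unfolding has_gelfand_integral_def using int
    by (simp add: IF F_def cong: Bochner_Integration.integrable_cong Bochner_Integration.integral_cong)
  then show thesis by (rule that) (simp add: IF CS)
qed

text \<open>Take \<open>y = X u\<close> in \<open>dom\<close> and cancel
  \<open>(norm (X u))^2\<close>. This carries the decay of \<open>sval P\<close> over to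
  \<open>X\<close>, and compactness of the powers of \<open>opabs X\<close> will rest on it.\<close>

lemma sval_le_sqrt:
  assumes X: "bop X" and P: "posop P" and Q: "posop Q"
    and dom: "\<And>x y. (cmod (cinner (X x) y))\<^sup>2 \<le> Re (cinner (P x) x) * Re (cinner (Q y) y)"
  shows "sval X n \<le> sqrt (onorm Q * sval P n)"
proof (rule sval_mono_fun)
  note bP = P[unfolded posop_def, THEN conjunct1] and bQ = Q[unfolded posop_def, THEN conjunct1]
  have Q0: "0 \<le> onorm Q" by (rule bop_onorm_nonneg[OF bQ])
  show "bop P" "bop X" by fact+
  show "isCont (\<lambda>c. sqrt (onorm Q * c)) c" for c by (intro continuous_intros)
  show "0 \<le> sqrt (onorm Q * c)" if "0 \<le> c" for c using Q0 that by simp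
  fix u and c :: real assume c: "0 \<le> c" "norm (P u) \<le> c * norm u"
  have le: "Re (cinner (S v) v) \<le> norm (S v) * norm v" for S :: "'a \<Rightarrow> 'a" and v
    by (meson cinner_Cauchy_Schwarz complex_Re_le_cmod order_trans)
  have "((norm (X u))\<^sup>2)\<^sup>2 = (cmod (cinner (X u) (X u)))\<^sup>2" by (simp only: cinner_self norm_of_real power2_abs)
  also have "\<dots> \<le> Re (cinner (P u) u) * Re (cinner (Q (X u)) (X u))" by (rule dom)
  also have "\<dots> \<le> (norm (P u) * norm u) * (norm (Q (X u)) * norm (X u))"
    by (intro mult_mono le) (use Q in \<open>auto simp: posop_def\<close>)
  also have "\<dots> \<le> ((c * norm u) * norm u) * ((onorm Q * norm (X u)) * norm (X u))"
    by (intro mult_mono c bop_onorm bQ) (use c Q0 in auto)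
  also have "\<dots> = (onorm Q * c * (norm u)\<^sup>2) * (norm (X u))\<^sup>2" by (simp add: power2_eq_square ac_simps)
  finally have "(norm (X u))\<^sup>2 * (norm (X u))\<^sup>2 \<le> (onorm Q * c * (norm u)\<^sup>2) * (norm (X u))\<^sup>2"
    by (simp add: power2_eq_square)
  then have "(norm (X u))\<^sup>2 \<le> onorm Q * c * (norm u)\<^sup>2"
  proof (cases "X u = 0")
    case True then show ?thesis using Q0 c by simp
  next
    case False
    then have "0 < (norm (X u))\<^sup>2" by simp
    with \<open>_ * _ \<le> _ * (norm (X u))\<^sup>2\<close> show ?thesis by (rule mult_right_le_imp_le)
  qed
  also have "\<dots> = (sqrt (onorm Q * c) * norm u)\<^sup>2" using Q0 c by (simp add: power_mult_distrib)
  finally show "norm (X u) \<le> sqrt (onorm Q * c) * norm u"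
    by (rule power2_le_imp_le) (use Q0 c in auto)
qed

lemma ui_norm_truncation_le:
  assumes "X \<in> ui_ideal \<Phi>" "sym_gauge \<Phi>"
  shows "\<Phi> (\<lambda>k. if k < n then sval X k else 0) \<le> enn2real (ui_norm \<Phi> X)"
proof -
  let ?x = "\<lambda>k. if k < n then sval X k else 0"
  have fin: "ui_norm \<Phi> X < \<infinity>" and c: "compact_op X" using assms by (auto simp: ui_ideal_def)
  have "ennreal (\<Phi> ?x) \<le> ui_norm \<Phi> X"
    using c SUP_upper[of n UNIV "\<lambda>n. ennreal (\<Phi> (\<lambda>k. if k < n then sval X k else 0))"]
    by (simp add: ui_norm_def)
  then have "enn2real (ennreal (\<Phi> ?x)) \<le> enn2real (ui_norm \<Phi> X)" using fin by (intro enn2real_mono) auto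
  moreover have "0 \<le> \<Phi> ?x" using assms(2) by (intro gauge_nonneg fin_suppI[of n]) auto
  ultimately show ?thesis by simp
qed

theorem theorem2p5:
  fixes M :: "'t measure" and \<theta> :: real and \<Phi> :: "(nat \<Rightarrow> real) \<Rightarrow> real"
    and A B :: "'t \<Rightarrow> 'h::complex_hilbert \<Rightarrow> 'h"
    and IA IB :: "'h \<Rightarrow> 'h"
  assumes "\<theta> > 0" and "sym_gauge \<Phi>"
    and "wstar_measurable M A" and "wstar_measurable M B"
    and "has_gelfand_integral M (\<lambda>t. opabs (A t) \<circ> opabs (A t)) IA"
    and "has_gelfand_integral M (\<lambda>t. opabs (B t) \<circ> opabs (B t)) IB"
    and "oppow (opabs IA) \<theta> \<in> ui_ideal \<Phi>"
    and "oppow (opabs IB) \<theta> \<in> ui_ideal \<Phi>"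
  shows "\<exists>I J K.
           has_gelfand_integral M (\<lambda>t. adj (A t) \<circ> B t) I \<and>
           has_gelfand_integral M (\<lambda>t. adj (A t) \<circ> A t) J \<and>
           has_gelfand_integral M (\<lambda>t. adj (B t) \<circ> B t) K \<and>
           ui_norm \<Phi> (oppow (opabs I) \<theta>) \<le>
             ennreal (sqrt (enn2real (ui_norm \<Phi> (oppow (opabs J) \<theta>))) *
                      sqrt (enn2real (ui_norm \<Phi> (oppow (opabs K) \<theta>))))"
proof -
  note \<theta> = assms(1) and \<Phi> = assms(2)
  interpret A: square_integrable_field M A IA by standard fact+
  interpret B: square_integrable_field M B IB by standard fact+
  obtain I where I: "has_gelfand_integral M (\<lambda>t. adj (A t) \<circ> B t) I"
    and dom: "\<And>f g. (cmod (cinner (I f) g))\<^sup>2 \<le> Re (cinner (IB f) f) * Re (cinner (IA g) g)"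
    using gelfand_integral_product[OF A.square_integrable_field_axioms B.square_integrable_field_axioms]
    by metis
  have bI: "bop I" using I by (simp add: has_gelfand_integral_def)
  note bA = A.bop_integral and bB = B.bop_integral
  note pos = sval_nonneg[OF bI] sval_nonneg[OF bA] sval_nonneg[OF bB]
  let ?a = "\<lambda>k. sval I k powr \<theta>" and ?p = "\<lambda>k. sval IA k powr \<theta>" and ?q = "\<lambda>k. sval IB k powr \<theta>"
  let ?L = "oppow (opabs I) \<theta>"
  have sv: "sval ?L = ?a" "sval (oppow (opabs IA) \<theta>) = ?p" "sval (oppow (opabs IB) \<theta>) = ?q"
    using sval_oppow_opabs[OF _ \<theta>] bI bA bB by auto
  \<comment> \<open>\<open>ui_norm\<close> is infinite off the compact operators, so compactness
    comes first; it follows from the decay of the approximation numbers of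
    \<open>IB\<close>.\<close>
  have "compact_op ?L"
  proof (rule compact_op_of_sval_tendsto_0)
    show "bop ?L" using posop_oppow[OF posop_opabs[OF bI] \<theta>] by (simp add: posop_def)
    have "?q \<longlonglongrightarrow> 0"
      using compact_op_sval_tendsto_0[of "oppow (opabs IB) \<theta>"] assms(8) sv by (simp add: ui_ideal_def)
    then have "(\<lambda>n. onorm IA powr (\<theta> / 2) * sqrt (?q n)) \<longlonglongrightarrow> onorm IA powr (\<theta> / 2) * sqrt 0"
      by (intro tendsto_intros)
    then have lim: "(\<lambda>n. onorm IA powr (\<theta> / 2) * sqrt (?q n)) \<longlonglongrightarrow> 0" by simp
    have le: "?a n \<le> onorm IA powr (\<theta> / 2) * sqrt (?q n)" for n
    proof -
      have "?a n \<le> sqrt (onorm IA * sval IB n) powr \<theta>"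
        using sval_le_sqrt[OF bI B.posop_integral A.posop_integral dom] pos \<theta> by (intro powr_mono2) auto
      also have "\<dots> = onorm IA powr (\<theta> / 2) * sqrt (?q n)"
        using pos bop_onorm_nonneg[OF bA] by (simp add: powr_half_sqrt[symmetric] powr_powr powr_mult)
      finally show ?thesis .
    qed
    show "sval ?L \<longlonglongrightarrow> 0" unfolding sv
      by (rule tendsto_sandwich[OF _ _ tendsto_const lim]) (simp_all add: le)
  qed
  then have "ui_norm \<Phi> ?L = (SUP n. ennreal (\<Phi> (\<lambda>k. if k < n then ?a k else 0)))"
    by (simp only: ui_norm_def sv if_True)
  also have "\<dots> \<le> ennreal (sqrt (enn2real (ui_norm \<Phi> (oppow (opabs IA) \<theta>))) *
      sqrt (enn2real (ui_norm \<Phi> (oppow (opabs IB) \<theta>))))"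
  proof (rule SUP_least, rule ennreal_leI)
    fix n
    have "\<Phi> (\<lambda>k. if k < n then ?a k else 0)
        \<le> sqrt (\<Phi> (\<lambda>k. if k < n then ?p k else 0)) * sqrt (\<Phi> (\<lambda>k. if k < n then ?q k else 0))"
    proof (rule gauge_truncation_le[OF \<Phi>])
      show "antimono ?a"
        using sval_antimono[OF bI] pos \<theta> by (auto simp: antimono_def intro!: powr_mono2)
      show "(\<Prod>k<m. ?a k) \<le> (\<Prod>k<m. sqrt (?p k * ?q k))" for m
      proof -
        \<comment> \<open>\<open>prod_sval_le\<close> bounds products of squares, so
          \<open>?a\<close> is written as the \<open>\<theta> / 2\<close> power of a square and that
          inequality is raised to the power \<open>\<theta> / 2\<close>.\<close>
        have "(\<Prod>k<m. ?a k) = (\<Prod>k<m. (sval I k)\<^sup>2 powr (\<theta> / 2))"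
          using pos by (intro prod.cong) (simp_all add: powr_powr flip: powr_numeral)
        also have "\<dots> = (\<Prod>k<m. (sval I k)\<^sup>2) powr (\<theta> / 2)"
          by (rule prod_powr_distrib[symmetric])
        also have "\<dots> \<le> ((\<Prod>k<m. sval IB k) * (\<Prod>k<m. sval IA k)) powr (\<theta> / 2)"
          using \<theta> by (intro powr_mono2 prod_sval_le[OF bI B.posop_integral A.posop_integral dom] prod_nonneg) auto
        also have "\<dots> = (\<Prod>k<m. sval IB k * sval IA k) powr (\<theta> / 2)" by (simp add: prod.distrib)
        also have "\<dots> = (\<Prod>k<m. (sval IB k * sval IA k) powr (\<theta> / 2))"
          by (rule prod_powr_distrib)
        also have "\<dots> = (\<Prod>k<m. sqrt (?p k * ?q k))"
          using pos by (intro prod.cong) (simp_all add: powr_half_sqrt[symmetric] powr_powr powr_mult mult.commute)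
        finally show ?thesis .
      qed
    qed auto
    also have "\<dots> \<le> sqrt (enn2real (ui_norm \<Phi> (oppow (opabs IA) \<theta>))) *
        sqrt (enn2real (ui_norm \<Phi> (oppow (opabs IB) \<theta>)))"
      using ui_norm_truncation_le[OF assms(7) \<Phi>, of n, unfolded sv]
        ui_norm_truncation_le[OF assms(8) \<Phi>, of n, unfolded sv]
        gauge_nonneg[OF \<Phi> fin_suppI[of n "\<lambda>k. if k < n then ?q k else 0"]]
      by (intro mult_mono) auto
    finally show "\<Phi> (\<lambda>k. if k < n then ?a k else 0) \<le> sqrt (enn2real (ui_norm \<Phi> (oppow (opabs IA) \<theta>))) *
        sqrt (enn2real (ui_norm \<Phi> (oppow (opabs IB) \<theta>)))" .
  qed
  \<comment> \<open>\<open>IA\<close> and \<open>IB\<close> serve as \<open>J\<close> and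
    \<open>K\<close>, because the square of \<open>opabs (A t)\<close> is \<open>adj (A t)\<close>
    after \<open>A t\<close>, and likewise for \<open>B\<close>.\<close>
  finally show ?thesis using I A.has_gelfand_adj B.has_gelfand_adj by blast
qed

end
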